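(* Let $m_1,m_2>0$ with $2m_1+m_2=3$ and let $E<0$. Then Broucke's isosceles orbit exists as a periodic solution of the four-degrees-of-freedom Hamiltonian system $Q_i'=\partial\Gamma/\partial P_i$, $P_i'=-\partial\Gamma/\partial Q_i$ ($i=1,2,3,4$) on the level set $\Gamma=0$. That is, there exist $s_0>0$ and real numbers $\zeta_1>0$, $\zeta_4>0$, $\zeta_8\neq 0$ and a $4s_0$-periodic solution $\gamma(s)=(Q_1,Q_2,Q_3,Q_4,P_1,P_2,P_3,P_4)(s)$, contained in $\{\Gamma=0\}$, such that: (1) $Q_2=Q_3=P_2=P_3=0$ for all $s$; (2) $\gamma(0)=(0,0,0,\zeta_4,2m_1^{3/2},0,0,0)$ (binary collision of the two bodies of mass $m_1$ on the positive $y$-axis); (3) $\gamma(s_0)=(\zeta_1,0,0,0,0,0,0,\zeta_8)$ (collinear configuration on the $x$-axis); (4) on $[0,s_0]$ the function $Q_1$ is strictly increasing and $Q_4$ is strictly decreasing; (5) the rest of the orbit is the symmetric extension $\gamma(2s_0-s)=-S\gamma(s)$ and $\gamma(-s)=S\gamma(s)$ for all $s$, where $S=\operatorname{diag}(-1,1,-1,1,1,-1,1,-1)$.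
   Context: Consider the planar Newtonian three-body problem with center of mass at the origin and zero net momentum, where bodies at $(q_1,q_2)$ and $(q_3,q_4)$ have mass $m_1$, and the body at $(q_5,q_6)$ has mass $m_2$; $p_i=m_1\dot q_i$ for $i\le 4$. New variables are introduced by $u_1=q_1-q_3$, $u_2=q_2-q_4$, $u_3=q_1+q_3$, $u_4=q_2+q_4$, $v_1=(p_1-p_3)/2$, $v_2=(p_2-p_4)/2$, $v_3=(p_1+p_3)/2$, $v_4=(p_2+p_4)/2$, and then $u_1=Q_1^2-Q_2^2$, $u_2=2Q_1Q_2$, $u_3=Q_3$, $u_4=Q_4$, $P_1=2v_1Q_1-2v_2Q_2$, $P_2=2v_1Q_2+2v_2Q_1$, $P_3=v_3$, $P_4=v_4$. Time is rescaled by $dt/ds=Q_1^2+Q_2^2$, and $'=d/ds$. With energy $E$, $\mu=\frac12+\frac{m_1}{m_2}$ and $\mathbf{Q}=(Q_1^2-Q_2^2)Q_3+2Q_1Q_2Q_4$, the regularized Hamiltonian is $$\Gamma=\frac{P_1^2+P_2^2}{4m_1}+(P_3^2+P_4^2)(Q_1^2+Q_2^2)\left(\frac1{m_1}+\frac2{m_2}\right)-\frac{m_1m_2(Q_1^2+Q_2^2)}{\sqrt{\frac14(Q_1^2+Q_2^2)^2+\mu\mathbf{Q}+\mu^2(Q_3^2+Q_4^2)}}-\frac{m_1m_2(Q_1^2+Q_2^2)}{\sqrt{\frac14(Q_1^2+Q_2^2)^2-\mu\mathbf{Q}+\mu^2(Q_3^2+Q_4^2)}}-m_1^2-E(Q_1^2+Q_2^2),$$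 defined where both radicands are positive; orbits of the original problem with energy $E$ correspond to $\Gamma=0$. Broucke's isosceles orbit is the periodic orbit that is at all times an isosceles triangle symmetric about the $y$-axis (possibly degenerate): starting from collision of the two mass $m_1$ bodies on the positive $y$-axis, these bodies move outward symmetrically while the mass $m_2$ body moves upward along the negative $y$-axis, until all three are collinear on the $x$-axis; the motion then continues in reverse with vertical coordinates negated, to a collision of the mass $m_1$ bodies on the negative $y$-axis, after which the bodies retrace the same paths back. *)

theory Defs
  imports "HOL-Analysis.Analysis"
begin

text \<open>A phase point is a pair (Q, P) of positions and momenta. The index type 4 of real^4 has the
  elements 1, 2, 3, 4, where 4 = 0 is the last one.\<close>

type_synonym phase = "(real^4) \<times> (real^4)"

definition mu :: "real \<Rightarrow> real \<Rightarrow> real" where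
  "mu m1 m2 = 1 / 2 + m1 / m2"

definition Qbold :: "real^4 \<Rightarrow> real" where
  "Qbold Q = ((Q$1)\<^sup>2 - (Q$2)\<^sup>2) * Q$3 + 2 * Q$1 * Q$2 * Q$4"

text \<open>The two radicands (the squared distances from each mass-m1 body to the mass-m2 body).\<close>

definition radicand_plus :: "real \<Rightarrow> real \<Rightarrow> real^4 \<Rightarrow> real" where
  "radicand_plus m1 m2 Q =
     1 / 4 * ((Q$1)\<^sup>2 + (Q$2)\<^sup>2)\<^sup>2 + mu m1 m2 * Qbold Q + (mu m1 m2)\<^sup>2 * ((Q$3)\<^sup>2 + (Q$4)\<^sup>2)"

definition radicand_minus :: "real \<Rightarrow> real \<Rightarrow> real^4 \<Rightarrow> real" where
  "radicand_minus m1 m2 Q =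
     1 / 4 * ((Q$1)\<^sup>2 + (Q$2)\<^sup>2)\<^sup>2 - mu m1 m2 * Qbold Q + (mu m1 m2)\<^sup>2 * ((Q$3)\<^sup>2 + (Q$4)\<^sup>2)"

definition Gamma :: "real \<Rightarrow> real \<Rightarrow> real \<Rightarrow> real^4 \<Rightarrow> real^4 \<Rightarrow> real" where
  "Gamma m1 m2 E Q P =
     ((P$1)\<^sup>2 + (P$2)\<^sup>2) / (4 * m1)
     + ((P$3)\<^sup>2 + (P$4)\<^sup>2) * ((Q$1)\<^sup>2 + (Q$2)\<^sup>2) * (1 / m1 + 2 / m2)
     - m1 * m2 * ((Q$1)\<^sup>2 + (Q$2)\<^sup>2) / sqrt (radicand_plus m1 m2 Q)
     - m1 * m2 * ((Q$1)\<^sup>2 + (Q$2)\<^sup>2) / sqrt (radicand_minus m1 m2 Q)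
     - m1\<^sup>2 - E * ((Q$1)\<^sup>2 + (Q$2)\<^sup>2)"

text \<open>The set on which the Hamiltonian is defined. The terms of \<^const>\<open>Gamma\<close> have (meaningless)
  values elsewhere too, so membership in this set is always required explicitly.\<close>

definition Gamma_domain :: "real \<Rightarrow> real \<Rightarrow> phase set" where
  "Gamma_domain m1 m2 = {(Q, P). radicand_plus m1 m2 Q > 0 \<and> radicand_minus m1 m2 Q > 0}"

definition zero_level :: "real \<Rightarrow> real \<Rightarrow> real \<Rightarrow> phase set" where
  "zero_level m1 m2 E = {(Q, P). (Q, P) \<in> Gamma_domain m1 m2 \<and> Gamma m1 m2 E Q P = 0}"

definition partial_deriv :: "(real^4 \<Rightarrow> real) \<Rightarrow> 4 \<Rightarrow> real^4 \<Rightarrow> real" where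
  "partial_deriv f i x = deriv (\<lambda>h. f (x + h *\<^sub>R axis i 1)) 0"

text \<open>On \<^const>\<open>Gamma_domain\<close> the function \<^const>\<open>Gamma\<close> is smooth, so the total operator \<^const>\<open>deriv\<close>
  yields the genuine partial derivatives there.\<close>

definition hamiltonian_solution ::
  "real \<Rightarrow> real \<Rightarrow> real \<Rightarrow> (real \<Rightarrow> phase) \<Rightarrow> bool" where
  "hamiltonian_solution m1 m2 E \<gamma> \<longleftrightarrow>
     (\<forall>s. \<gamma> s \<in> Gamma_domain m1 m2 \<and>
       (\<forall>i.
         ((\<lambda>t. fst (\<gamma> t) $ i) has_real_derivative
            partial_deriv (\<lambda>P. Gamma m1 m2 E (fst (\<gamma> s)) P) i (snd (\<gamma> s))) (at s) \<and>
         ((\<lambda>t. snd (\<gamma> t) $ i) has_real_derivative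
            - partial_deriv (\<lambda>Q. Gamma m1 m2 E Q (snd (\<gamma> s))) i (fst (\<gamma> s))) (at s)))"

text \<open>The linear map diag(-1, 1, -1, 1, 1, -1, 1, -1) in the coordinates (Q, P).\<close>

definition S_sym :: "phase \<Rightarrow> phase" where
  "S_sym z = (case z of (Q, P) \<Rightarrow>
     (vector [- Q$1, Q$2, - Q$3, Q$4], vector [P$1, - P$2, P$3, - P$4]))"

end

theory Submission
  imports Defs
begin

text \<open>
  On the slice \<open>Q\<^sub>2 = Q\<^sub>3 = P\<^sub>2 = P\<^sub>3 = 0\<close>, which the flow preserves, the system has two degrees of
  freedom. Write \<open>x = Q\<^sub>1\<close>, \<open>y = Q\<^sub>4\<close>, \<open>p = P\<^sub>1\<close>, \<open>q = P\<^sub>4\<close>. It is reversible with respect to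
  \<open>(x, y, p, q) \<mapsto> (- x, y, p, - q)\<close>, which fixes the binary collision \<open>x = q = 0\<close>, and with respect to
  \<open>(x, y, p, q) \<mapsto> (x, - y, - p, q)\<close>, which fixes the points \<open>y = p = 0\<close>. A solution that joins two
  such points is therefore a quarter of a symmetric periodic orbit (lemma symmetric_extension), and
  what must be found is a height \<open>a > 0\<close> such that the solution starting at \<open>(0, a, 2 m1 powr (3/2), 0)\<close>
  reaches \<open>y = 0\<close> and \<open>p = 0\<close> at the same instant. This is a shooting problem in the parameter \<open>a\<close>.

  Every solution leaves the quadrant \<open>y > 0, p > 0\<close>, because there \<open>x\<close> increases and \<open>q\<close> decreases
  below zero, so that \<open>y' = 2 c x\<^sup>2 q\<close> stays below a negative constant (quadrant_is_left). At the exit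
  \<open>y\<close> or \<open>p\<close> vanishes, and it crosses zero with nonzero speed: for \<open>y\<close> because \<open>q < 0\<close>, for \<open>p\<close>
  because of the energy relation (dp_neg). So the heights for which \<open>y\<close> vanishes strictly first form
  an open set, and so do those for which \<open>p\<close> does. Both sets are nonempty:

  \<^item> If \<open>a\<close> is large, the body of mass \<open>m2\<close> hardly disturbs the binary, whose regularised motion is
    nearly a harmonic oscillator of frequency \<open>sqrt (\<bar>E\<bar> / m1)\<close>; a Sturm comparison shows that
    \<open>p\<close> vanishes before \<open>y\<close> has dropped to \<open>a / 2\<close> (y_pos_at_end_if_far).

  \<^item> If \<open>a\<close> is small, the energy is negligible. The generator of dilations \<open>G = x p / 2 + y q\<close>
    satisfies the Lagrange-Jacobi identity \<open>G' = m1\<^sup>2 + 2 x\<^sup>2 (m1 m2 / r + E)\<close>, so it increases as long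
    as \<open>x\<close> is small (expansion). Since \<open>y q \<le> 0\<close>, this keeps \<open>p\<close> positive and makes \<open>x\<close> grow at
    least linearly in time, and then \<open>y\<close> falls to zero within a time of order \<open>sqrt a\<close>
    (duration_if_near), while \<open>x\<close> is still small.

  As an interval of heights is connected, some \<open>a\<close> lies in neither set (shooting).

  The vector field is singular at the triple collision \<open>x = y = 0\<close>. The same estimates show that,
  for \<open>a\<close> in a compact interval, solutions in the quadrant stay in one compact set without that
  point (uniform_bounds). Outside a neighbourhood of this set the field may be changed, and clamping
  the variables makes it globally Lipschitz without affecting the reversing symmetries. For such
  fields global solutions exist, are unique and depend continuously on the initial value, which is
  all the theory of differential equations that the argument needs.
\<close>

section \<open>Ordinary differential equations with a globally Lipschitz right-hand side\<close>

lemma antiderivative_on_reals: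
  fixes g :: "real \<Rightarrow> 'a::banach"
  assumes cont: "continuous_on UNIV g"
  obtains J where "J 0 = 0" and "\<And>t. (J has_vector_derivative g t) (at t)"
proof -
  define J where "J t = (if 0 \<le> t then integral {0..t} g else - integral {t..0} g)" for t
  have "(J has_vector_derivative g t) (at t)" for t
  proof -
    define n where "n = \<bar>t\<bar> + 1"
    have tn: "t \<in> {-n<..<n}" by (auto simp: n_def)
    have int: "g integrable_on {a..b}" for a b :: real
      by (meson cont continuous_on_subset integrable_continuous_real subset_UNIV)
    have J: "J u = integral {-n..u} g - integral {-n..0} g" if "u \<in> {-n<..<n}" for u
    proof (cases "0 \<le> u")
      case True
      then have "integral {-n..0} g + integral {0..u} g = integral {-n..u} g"
        using that int by (intro Henstock_Kurzweil_Integration.integral_combine) (auto simp: n_def)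
      then show ?thesis using True by (simp add: J_def algebra_simps)
    next
      case False
      then have "integral {-n..u} g + integral {u..0} g = integral {-n..0} g"
        using that int by (intro Henstock_Kurzweil_Integration.integral_combine) (auto simp: n_def)
      then show ?thesis using False by (simp add: J_def algebra_simps)
    qed
    have "((\<lambda>u. integral {-n..u} g) has_vector_derivative g t) (at t within {-n..n})"
      by (rule integral_has_vector_derivative) (use cont tn continuous_on_subset in auto)
    then have "((\<lambda>u. integral {-n..u} g) has_vector_derivative g t) (at t)"
      using tn by (simp add: at_within_Icc_at)
    then have "((\<lambda>u. integral {-n..u} g - integral {-n..0} g) has_vector_derivative g t) (at t)"
      by (auto intro!: derivative_eq_intros)
    then show "(J has_vector_derivative g t) (at t)"
      by (rule has_vector_derivative_transform_within_open[of _ _ _ "{-n<..<n}"]) (use tn J in auto)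
  qed
  moreover have "J 0 = 0" by (simp add: J_def)
  ultimately show thesis by (rule that[rotated])
qed

text \<open>Estimates the integral operator in the exponentially weighted norm: a large rate \<open>K\<close> makes it small.\<close>

lemma norm_le_exp_of_derivative:
  fixes J g :: "real \<Rightarrow> 'a::real_normed_vector"
  assumes J0: "J 0 = 0" and J: "\<And>t. (J has_vector_derivative g t) (at t)"
    and g: "\<And>t. norm (g t) \<le> B * exp (K * \<bar>t\<bar>)" and "K > 0"
  shows "norm (J t) \<le> B / K * exp (K * \<bar>t\<bar>)"
proof -
  have B: "0 \<le> B" using order_trans[OF norm_ge_zero g[of 0]] by simp
  have pos: "norm (I t) \<le> B / K * exp (K * t)"
    if "0 < t" "I 0 = 0" "\<And>t. (I has_vector_derivative h t) (at t)"
      "\<And>t. 0 \<le> t \<Longrightarrow> norm (h t) \<le> B * exp (K * t)" for t and I h :: "real \<Rightarrow> 'a"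
  proof -
    have contI: "continuous_on {0..t} I"
      using that(3) has_vector_derivative_continuous continuous_at_imp_continuous_on by blast
    have "norm (I t - I 0) \<le> B / K * exp (K * t) - B / K * exp (K * 0)"
    proof (rule differentiable_bound_general[of 0 t I "\<lambda>s. B / K * exp (K * s)" h "\<lambda>s. B * exp (K * s)"])
      show "continuous_on {0..t} (\<lambda>s. B / K * exp (K * s))" by (intro continuous_intros)
      show "((\<lambda>s. B / K * exp (K * s)) has_vector_derivative B * exp (K * s)) (at s)" for s
        unfolding has_real_derivative_iff_has_vector_derivative[symmetric]
        using \<open>K > 0\<close> by (auto intro!: derivative_eq_intros)
    qed (use that contI in auto)
    also have "\<dots> \<le> B / K * exp (K * t)" using B \<open>K > 0\<close> by simp
    finally show ?thesis using that by simp
  qed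
  consider "t = 0" | "t > 0" | "t < 0" by linarith
  then show ?thesis
  proof cases
    case 1 then show ?thesis using J0 B \<open>K > 0\<close> by simp
  next
    case 2 then show ?thesis using pos[of t J g] J0 J g by (metis abs_of_nonneg less_imp_le)
  next
    case 3
    have "((\<lambda>t. J (- t)) has_vector_derivative - g (- t)) (at t)" for t
    proof -
      have "(uminus has_vector_derivative - 1) (at (t::real))"
        unfolding has_real_derivative_iff_has_vector_derivative[symmetric]
        by (auto intro!: derivative_eq_intros)
      from vector_diff_chain_at[OF this J] show ?thesis by (simp add: o_def)
    qed
    moreover have "norm (- g (- t)) \<le> B * exp (K * t)" if "0 \<le> t" for t
      using g[of "- t"] that by simp
    ultimately have "norm (J (- (- t))) \<le> B / K * exp (K * (- t))"
      using 3 J0 by (intro pos[of "- t" "\<lambda>t. J (- t)" "\<lambda>t. - g (- t)"]) auto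
    then show ?thesis using 3 by simp
  qed
qed

text \<open>With \<open>z = w f\<close>, where \<open>w t = exp (K \<bar>t\<bar>)\<close> and \<open>f\<close> is bounded, the integral equation becomes a
  fixed point equation for \<open>f\<close> in the space of bounded continuous functions on the whole line. Its
  right-hand side contracts by the factor \<open>L / K\<close>, so one application of Banach's theorem gives a
  global solution, without gluing local ones.\<close>

theorem lipschitz_ode_solution_exists:
  fixes F :: "'a::banach \<Rightarrow> 'a"
  assumes L: "L-lipschitz_on UNIV F"
  obtains z where "z 0 = z0" and "\<And>t. (z has_vector_derivative F (z t)) (at t)"
proof -
  have L0: "0 \<le> L" using L by (rule lipschitz_on_nonneg)
  define K where "K = L + 1"
  have K: "K > 0" using L0 by (simp add: K_def)
  define w where "w t = exp (K * \<bar>t\<bar>)" for t :: real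
  have w0: "w t > 0" for t by (simp add: w_def)
  have le_mult_w: "b \<le> b * w t" if "0 \<le> b" for b t
    using that mult_left_mono[of 1 "w t" b] K by (simp add: w_def)
  have contw: "continuous_on UNIV w" unfolding w_def by (intro continuous_intros)
  have contF: "continuous_on UNIV F" using L by (rule lipschitz_on_continuous_on)
  have contG: "continuous_on UNIV (\<lambda>t. F (w t *\<^sub>R apply_bcontfun f t))" for f :: "real \<Rightarrow>\<^sub>C 'a"
    by (rule continuous_on_compose2[OF contF]) (auto intro!: continuous_intros contw)
  have "\<exists>J. J 0 = 0 \<and> (\<forall>t. (J has_vector_derivative F (w t *\<^sub>R apply_bcontfun f t)) (at t))"
    for f :: "real \<Rightarrow>\<^sub>C 'a"
    using antiderivative_on_reals[OF contG[of f]] by metis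
  then obtain J where J0: "\<And>f. J f 0 = 0"
    and J: "\<And>f t. (J f has_vector_derivative F (w t *\<^sub>R apply_bcontfun f t)) (at t)"
    by metis
  have contJ: "continuous_on UNIV (J f)" for f
    by (meson J continuous_at_imp_continuous_on has_vector_derivative_continuous)
  have growth: "norm (F (w t *\<^sub>R apply_bcontfun f t)) \<le> (norm (F 0) + L * norm f) * exp (K * \<bar>t\<bar>)" for f t
  proof -
    have "norm (F (w t *\<^sub>R f t)) \<le> norm (F 0) + norm (F (w t *\<^sub>R f t) - F 0)"
      by (metis add.commute diff_add_cancel norm_triangle_ineq)
    also have "\<dots> \<le> norm (F 0) + L * norm (w t *\<^sub>R f t)"
      using lipschitz_on_normD[OF L, of "w t *\<^sub>R f t" 0] by simp
    also have "norm (w t *\<^sub>R f t) \<le> w t * norm f"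
      using norm_bounded[of f t] w0[of t] by simp
    also have "norm (F 0) \<le> norm (F 0) * w t"
      by (rule le_mult_w) simp
    finally show ?thesis using L0 by (simp add: w_def distrib_right mult.assoc mult.commute[of "norm f"] mult_left_mono)
  qed
  define P where "P f t = (1 / w t) *\<^sub>R (z0 + J f t)" for f and t :: real
  have P_bc: "P f \<in> bcontfun" for f
  proof (rule bcontfun_normI)
    show "continuous_on UNIV (P f)" unfolding P_def
      by (intro continuous_intros contw contJ) (metis w0 less_irrefl)
    fix t
    have "norm (P f t) \<le> (1 / w t) * (norm z0 + norm (J f t))"
      using w0[of t] by (simp add: P_def divide_right_mono norm_triangle_ineq)
    also have "norm (J f t) \<le> (norm (F 0) + L * norm f) / K * w t"
      unfolding w_def by (rule norm_le_exp_of_derivative[OF J0 J growth K])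
    also have "norm z0 \<le> norm z0 * w t"
      by (rule le_mult_w) simp
    finally have "norm (P f t) \<le> (1 / w t) * ((norm z0 + (norm (F 0) + L * norm f) / K) * w t)"
      using w0[of t] by (simp add: distrib_right divide_right_mono)
    then show "norm (P f t) \<le> norm z0 + (norm (F 0) + L * norm f) / K"
      using w0[of t] by simp
  qed
  define \<Phi> where "\<Phi> f = Bcontfun (P f)" for f
  have \<Phi>: "apply_bcontfun (\<Phi> f) = P f" for f
    unfolding \<Phi>_def using P_bc by (rule Bcontfun_inverse)
  have "dist (\<Phi> f) (\<Phi> g) \<le> L / K * dist f g" for f g
  proof (rule dist_bound)
    fix t
    have "norm (J f t - J g t) \<le> (L * dist f g) / K * exp (K * \<bar>t\<bar>)"
    proof (rule norm_le_exp_of_derivative[where J = "\<lambda>t. J f t - J g t"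
          and g = "\<lambda>t. F (w t *\<^sub>R apply_bcontfun f t) - F (w t *\<^sub>R apply_bcontfun g t)"])
      fix t
      have "norm (F (w t *\<^sub>R f t) - F (w t *\<^sub>R g t)) \<le> L * norm (w t *\<^sub>R f t - w t *\<^sub>R g t)"
        using lipschitz_on_normD[OF L] by blast
      also have "norm (w t *\<^sub>R f t - w t *\<^sub>R g t) = w t * dist (f t) (g t)"
        using w0[of t] by (simp add: dist_norm flip: scaleR_diff_right)
      also have "\<dots> \<le> w t * dist f g"
        using dist_bounded[of f t g] w0[of t] by simp
      finally show "norm (F (w t *\<^sub>R f t) - F (w t *\<^sub>R g t)) \<le> L * dist f g * exp (K * \<bar>t\<bar>)"
        using L0 by (simp add: w_def mult_left_mono mult.assoc mult.commute[of "dist f g"])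
    qed (use J0 K in \<open>auto intro!: derivative_eq_intros J\<close>)
    moreover have "dist (P f t) (P g t) = (1 / w t) * norm (J f t - J g t)"
      using w0[of t] by (simp add: P_def dist_norm flip: scaleR_diff_right)
    ultimately show "dist (\<Phi> f t) (\<Phi> g t) \<le> L / K * dist f g"
      by (simp add: \<Phi> w_def pos_divide_le_eq)
  qed
  moreover have "0 \<le> L / K" "L / K < 1" using L0 by (auto simp: K_def)
  ultimately obtain f where "\<Phi> f = f" using banach_fix_type[of "L / K" \<Phi>] by blast
  then have f: "w t *\<^sub>R f t = z0 + J f t" for t
    using \<Phi>[of f] w0[of t] by (simp add: P_def)
  show thesis
  proof (rule that[of "\<lambda>t. w t *\<^sub>R f t"])
    show "w 0 *\<^sub>R f 0 = z0" using f[of 0] J0 by simp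
    fix t
    have "((\<lambda>t. z0 + J f t) has_vector_derivative F (w t *\<^sub>R f t)) (at t)"
      by (auto intro!: derivative_eq_intros J)
    then show "((\<lambda>t. w t *\<^sub>R f t) has_vector_derivative F (w t *\<^sub>R f t)) (at t)"
      by (simp add: f)
  qed
qed

text \<open>Gronwall's inequality: the squared distance of two solutions, damped by \<open>exp (- 2 L t)\<close>, decreases.\<close>

lemma lipschitz_ode_forward_dependence:
  fixes F :: "'a::real_inner \<Rightarrow> 'a"
  assumes L: "L-lipschitz_on UNIV F"
    and z: "\<And>t. (z has_vector_derivative F (z t)) (at t)"
    and w: "\<And>t. (w has_vector_derivative F (w t)) (at t)" and "0 \<le> t"
  shows "dist (z t) (w t) \<le> exp (L * t) * dist (z 0) (w 0)"
proof -
  define D where "D t = exp (- 2 * L * t) * ((z t - w t) \<bullet> (z t - w t))" for t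
  have d: "((\<lambda>t. z t - w t) has_derivative (\<lambda>h. h *\<^sub>R (F (z t) - F (w t)))) (at t)" for t
    using has_vector_derivative_diff[OF z w] by (simp add: has_vector_derivative_def)
  have D': "(D has_real_derivative
      exp (- 2 * L * t) * (2 * ((z t - w t) \<bullet> (F (z t) - F (w t))) - 2 * L * ((z t - w t) \<bullet> (z t - w t)))) (at t)" for t
  proof -
    have "((\<lambda>t. (z t - w t) \<bullet> (z t - w t)) has_derivative
        (\<lambda>h. (z t - w t) \<bullet> (h *\<^sub>R (F (z t) - F (w t))) + (h *\<^sub>R (F (z t) - F (w t))) \<bullet> (z t - w t))) (at t)"
      by (rule has_derivative_inner[OF d d])
    then have "((\<lambda>t. (z t - w t) \<bullet> (z t - w t)) has_real_derivative
        2 * ((z t - w t) \<bullet> (F (z t) - F (w t)))) (at t)"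
      unfolding has_field_derivative_def
      by (rule has_derivative_eq_rhs) (simp add: fun_eq_iff inner_commute)
    moreover have "((\<lambda>t. exp (- 2 * L * t)) has_real_derivative - 2 * L * exp (- 2 * L * t)) (at t)"
      by (auto intro!: derivative_eq_intros)
    ultimately have "(D has_real_derivative - 2 * L * exp (- 2 * L * t) * ((z t - w t) \<bullet> (z t - w t))
        + 2 * ((z t - w t) \<bullet> (F (z t) - F (w t))) * exp (- 2 * L * t)) (at t)"
      unfolding D_def by (rule DERIV_mult[rotated])
    then show ?thesis
      by (rule DERIV_cong) (simp add: right_diff_distrib)
  qed
  have "D t \<le> D 0"
  proof (rule DERIV_nonpos_imp_nonincreasing[OF \<open>0 \<le> t\<close>])
    fix s
    have "(z s - w s) \<bullet> (F (z s) - F (w s)) \<le> norm (z s - w s) * norm (F (z s) - F (w s))"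
      by (rule norm_cauchy_schwarz)
    also have "\<dots> \<le> norm (z s - w s) * (L * norm (z s - w s))"
      by (intro mult_left_mono lipschitz_on_normD[OF L]) auto
    finally have "(z s - w s) \<bullet> (F (z s) - F (w s)) \<le> L * ((z s - w s) \<bullet> (z s - w s))"
      by (simp add: dot_square_norm power2_eq_square mult_ac)
    then show "\<exists>y. (D has_real_derivative y) (at s) \<and> y \<le> 0"
      using D'[of s] by (metis (no_types, lifting) diff_le_0_iff_le exp_ge_zero mult.assoc
          mult_le_cancel_left_pos mult_nonneg_nonpos zero_less_numeral)
  qed
  then have "(norm (z t - w t))\<^sup>2 \<le> exp (2 * L * t) * (norm (z 0 - w 0))\<^sup>2"
    by (simp add: D_def dot_square_norm exp_minus field_simps)
  also have "\<dots> = (exp (L * t) * norm (z 0 - w 0))\<^sup>2"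
    by (simp add: power_mult_distrib flip: exp_double)
  finally show ?thesis unfolding dist_norm by (rule power2_le_imp_le) simp
qed

text \<open>Stated for an arbitrary time \<open>r\<close> of agreement, because the second symmetry of the orbit is pinned
  down at the end of the quarter orbit.\<close>

lemma lipschitz_ode_unique:
  fixes F :: "'a::real_inner \<Rightarrow> 'a"
  assumes L: "L-lipschitz_on UNIV F"
    and z: "\<And>t. (z has_vector_derivative F (z t)) (at t)"
    and w: "\<And>t. (w has_vector_derivative F (w t)) (at t)" and eq: "z r = w r"
  shows "z t = w t"
proof -
  have shift: "((\<lambda>t. v (r + \<sigma> * t)) has_vector_derivative \<sigma> *\<^sub>R F (v (r + \<sigma> * t))) (at t)"
    if "\<And>t. (v has_vector_derivative F (v t)) (at t)" for v :: "real \<Rightarrow> 'a" and \<sigma> t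
  proof -
    have "((\<lambda>t. r + \<sigma> * t) has_vector_derivative \<sigma>) (at t)"
      unfolding has_real_derivative_iff_has_vector_derivative[symmetric]
      by (auto intro!: derivative_eq_intros)
    from vector_diff_chain_at[OF this that] show ?thesis by (simp add: o_def)
  qed
  have Lm: "L-lipschitz_on UNIV (\<lambda>x. - F x)" using L by (rule lipschitz_on_minus)
  have fw: "z (r + s) = w (r + s)" if "0 \<le> s" for s
    using lipschitz_ode_forward_dependence[OF L, of "\<lambda>t. z (r + t)" "\<lambda>t. w (r + t)" s]
      shift[OF z, of 1] shift[OF w, of 1] that eq by simp
  have bw: "z (r - s) = w (r - s)" if "0 \<le> s" for s
    using lipschitz_ode_forward_dependence[OF Lm, of "\<lambda>t. z (r - t)" "\<lambda>t. w (r - t)" s]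
      shift[OF z, of "-1"] shift[OF w, of "-1"] that eq by simp
  show ?thesis
    using fw[of "t - r"] bw[of "r - t"] by (cases "r \<le> t") auto
qed

section \<open>First exit times and shooting\<close>

lemma first_zero:
  fixes \<phi> :: "real \<Rightarrow> real"
  assumes cont: "continuous_on UNIV \<phi>" and \<phi>0: "0 < \<phi> 0" and ex: "\<exists>t\<ge>0. \<phi> t \<le> 0"
  obtains T where "0 < T" "\<phi> T = 0" "\<And>s. \<lbrakk>0 \<le> s; s < T\<rbrakk> \<Longrightarrow> 0 < \<phi> s"
proof -
  obtain t where t: "0 \<le> t" "\<phi> t \<le> 0" using ex by blast
  have cont': "continuous_on A \<phi>" for A using cont continuous_on_subset by blast
  define S where "S = {0..t} \<inter> \<phi> -` {..0}"
  have "closed S" unfolding S_def by (intro continuous_closed_preimage cont') auto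
  then have "compact ({0..t} \<inter> S)" by (intro compact_Int_closed) auto
  also have "{0..t} \<inter> S = S" by (auto simp: S_def)
  finally have "compact S" .
  moreover have "t \<in> S" using t by (simp add: S_def)
  ultimately obtain T where T: "T \<in> S" "\<And>s. s \<in> S \<Longrightarrow> T \<le> s"
    using compact_attains_inf[of S] by blast
  have pos: "0 < \<phi> s" if "0 \<le> s" "s < T" for s
    using T(1) T(2)[of s] that by (force simp: S_def)
  have "0 \<le> \<phi> T"
  proof (rule ccontr)
    assume "\<not> 0 \<le> \<phi> T"
    then obtain s where s: "0 \<le> s" "s \<le> T" "\<phi> s = 0"
      using IVT2'[of \<phi> T 0 0] \<phi>0 T(1) cont' by (auto simp: S_def)
    then show False using pos[of s] \<open>\<not> 0 \<le> \<phi> T\<close> by (cases "s = T") auto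
  qed
  moreover have "\<phi> T \<le> 0" "0 \<le> T" using T(1) by (auto simp: S_def)
  ultimately show thesis using that[of T] pos \<phi>0 by (cases "T = 0") auto
qed

text \<open>The continuation principle for a priori estimates: an estimate that holds weakly (in \<open>K\<close>) up to a
  time and then improves to a strict one (in \<open>U\<close>) at that time can never fail.\<close>

lemma stays_in_open:
  fixes g :: "real \<Rightarrow> 'a::metric_space"
  assumes cont: "continuous_on {0..T} g" and "open U" "closed K" "U \<subseteq> K" and g0: "g 0 \<in> K"
    and improve: "\<And>t. \<lbrakk>0 \<le> t; t \<le> T; \<And>s. \<lbrakk>0 \<le> s; s \<le> t\<rbrakk> \<Longrightarrow> g s \<in> K\<rbrakk> \<Longrightarrow> g t \<in> U"
    and t: "0 \<le> t" "t \<le> T"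
  shows "g t \<in> U"
proof (rule ccontr)
  assume "g t \<notin> U"
  define S where "S = {0..T} \<inter> g -` (- U)"
  have "closed S" unfolding S_def using \<open>open U\<close>
    by (intro continuous_closed_preimage cont) auto
  then have "compact ({0..T} \<inter> S)" by (intro compact_Int_closed) auto
  also have "{0..T} \<inter> S = S" by (auto simp: S_def)
  finally have "compact S" .
  moreover have "t \<in> S" using t \<open>g t \<notin> U\<close> by (simp add: S_def)
  ultimately obtain r where r: "r \<in> S" "\<And>s. s \<in> S \<Longrightarrow> r \<le> s"
    using compact_attains_inf[of S] by blast
  have rT: "0 \<le> r" "r \<le> T" "g r \<notin> U" using r(1) by (auto simp: S_def)
  have U: "g s \<in> U" if "0 \<le> s" "s < r" for s
    using r(2)[of s] that rT by (force simp: S_def)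
  have "g s \<in> K" if s: "0 \<le> s" "s \<le> r" for s
  proof (cases "r = 0")
    case False
    have "g ` closure {0..<r} \<subseteq> K"
      using False rT U \<open>U \<subseteq> K\<close> \<open>closed K\<close>
      by (intro image_closure_subset continuous_on_subset[OF cont]) auto
    then show ?thesis using False rT s by auto
  qed (use s g0 in auto)
  then show False using improve[of r] rT by blast
qed

text \<open>A parameter that is neither in the set where \<open>Y\<close> becomes negative while \<open>P\<close> is still positive nor in
  the set with the roles exchanged must let both vanish at once. The hypotheses on derivatives say
  that zeros at the exit time are crossings, which puts \<open>a1\<close> and \<open>a2\<close> into the two sets; continuous
  dependence makes the sets open.\<close>

lemma shooting:
  fixes Y P :: "real \<Rightarrow> real \<Rightarrow> real"
  assumes contY: "\<And>a. continuous_on UNIV (Y a)" and contP: "\<And>a. continuous_on UNIV (P a)"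
    and dep: "\<And>a s e. \<lbrakk>0 \<le> s; 0 < e\<rbrakk> \<Longrightarrow> \<exists>d>0. \<forall>a'. \<bar>a' - a\<bar> < d \<longrightarrow>
        (\<forall>t\<in>{0..s}. \<bar>Y a' t - Y a t\<bar> < e \<and> \<bar>P a' t - P a t\<bar> < e)"
    and le: "a1 \<le> a2"
    and exit: "\<And>a. \<lbrakk>a1 \<le> a; a \<le> a2\<rbrakk> \<Longrightarrow> 0 < T a \<and> min (Y a (T a)) (P a (T a)) = 0 \<and>
        (\<forall>s\<in>{0..<T a}. 0 < Y a s \<and> 0 < P a s)"
    and crossY: "\<And>a. \<lbrakk>a1 \<le> a; a \<le> a2; Y a (T a) = 0\<rbrakk> \<Longrightarrow>
        \<exists>D<0. (Y a has_real_derivative D) (at (T a))"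
    and crossP: "\<And>a. \<lbrakk>a1 \<le> a; a \<le> a2; P a (T a) = 0\<rbrakk> \<Longrightarrow>
        \<exists>D<0. (P a has_real_derivative D) (at (T a))"
    and left: "0 < P a1 (T a1)" and right: "0 < Y a2 (T a2)"
  obtains a where "a1 \<le> a" "a \<le> a2" "Y a (T a) = 0" "P a (T a) = 0"
proof -
  \<comment> \<open>Parameters for which \<open>f\<close> becomes negative while \<open>g\<close> is still positive. Asking for a negative value
    instead of a zero makes the set open.\<close>
  define before :: "(real \<Rightarrow> real \<Rightarrow> real) \<Rightarrow> (real \<Rightarrow> real \<Rightarrow> real) \<Rightarrow> real set" where
    "before f g = {a. \<exists>s\<ge>0. f a s < 0 \<and> (\<forall>t\<in>{0..s}. 0 < g a t)}" for f g
  have open_before: "open (before f g)"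
    if contg: "\<And>a. continuous_on UNIV (g a)"
      and dep: "\<And>a s e. \<lbrakk>0 \<le> s; 0 < e\<rbrakk> \<Longrightarrow> \<exists>d>0. \<forall>a'. \<bar>a' - a\<bar> < d \<longrightarrow>
        (\<forall>t\<in>{0..s}. \<bar>f a' t - f a t\<bar> < e \<and> \<bar>g a' t - g a t\<bar> < e)" for f g
    unfolding open_dist
  proof
    fix a assume "a \<in> before f g"
    then obtain s where s: "0 \<le> s" "f a s < 0" "\<And>t. t \<in> {0..s} \<Longrightarrow> 0 < g a t"
      by (auto simp: before_def)
    have "continuous_on {0..s} (g a)" using contg continuous_on_subset by blast
    then obtain t where t: "t \<in> {0..s}" "\<And>u. u \<in> {0..s} \<Longrightarrow> g a t \<le> g a u"
      using continuous_attains_inf[of "{0..s}" "g a"] s(1) by auto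
    define e where "e = min (g a t) (- f a s)"
    have "0 < e" using s(2) s(3)[OF t(1)] by (simp add: e_def)
    from dep[OF s(1) this, of a] obtain d where d: "0 < d" "\<And>a' t. \<bar>a' - a\<bar> < d \<Longrightarrow> t \<in> {0..s} \<Longrightarrow>
        \<bar>f a' t - f a t\<bar> < e \<and> \<bar>g a' t - g a t\<bar> < e" by blast
    have "a' \<in> before f g" if "dist a' a < d" for a'
    proof -
      have a': "\<bar>a' - a\<bar> < d" using that by (simp add: dist_real_def)
      have "f a' s < 0" using d(2)[OF a', of s] s(1) unfolding e_def by simp linarith
      moreover have "0 < g a' u" if "u \<in> {0..s}" for u
        using d(2)[OF a' that] t(2)[OF that] unfolding e_def by simp linarith
      ultimately show ?thesis using s(1) by (auto simp: before_def)
    qed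
    then show "\<exists>e>0. \<forall>y. dist y a < e \<longrightarrow> y \<in> before f g" using d(1) by blast
  qed
  have in_before: "a \<in> before f g"
    if contg: "continuous_on UNIV (g a)" and T: "0 < S" "f a S = 0" "0 < g a S"
      and pos: "\<And>s. s \<in> {0..<S} \<Longrightarrow> 0 < g a s"
      and D: "D < 0" "(f a has_real_derivative D) (at S)" for f g a S D
  proof -
    obtain d where d: "0 < d" "\<And>h. \<lbrakk>0 < h; h < d\<rbrakk> \<Longrightarrow> f a (S + h) < f a S"
      using DERIV_neg_dec_right[OF D(2,1)] by blast
    have "isCont (g a) S" using contg by (simp add: continuous_on_eq_continuous_at)
    then obtain d' where d': "0 < d'" "\<And>t. dist t S < d' \<Longrightarrow> dist (g a t) (g a S) < g a S"
      using T(3) unfolding continuous_at_eps_delta by blast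
    define h where "h = min d d' / 2"
    have h: "0 < h" "h < d" "h < d'" using d(1) d'(1) by (auto simp: h_def)
    have "0 < g a t" if "t \<in> {0..S + h}" for t
    proof (cases "t < S")
      case False
      then have "dist t S < d'" using that h by (simp add: dist_real_def)
      then show ?thesis using d'(2)[of t] by (simp add: dist_real_def abs_if split: if_splits)
    qed (use pos that in auto)
    moreover have "f a (S + h) < 0" using d(2)[OF h(1,2)] T(2) by simp
    ultimately show ?thesis using T(1) h(1) unfolding before_def by (intro CollectI exI[of _ "S + h"]) auto
  qed
  have YP: "a \<in> before Y P" if a: "a1 \<le> a" "a \<le> a2" and "0 < P a (T a)" for a
  proof -
    have "Y a (T a) = 0" using exit[OF a] that(3) by (auto simp: min_def split: if_splits)
    then show ?thesis using crossY[OF a] exit[OF a] that(3) contP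
      by (auto intro!: in_before[of P a "T a" Y])
  qed
  have PY: "a \<in> before P Y" if a: "a1 \<le> a" "a \<le> a2" and "0 < Y a (T a)" for a
  proof -
    have "P a (T a) = 0" using exit[OF a] that(3) by (auto simp: min_def split: if_splits)
    then show ?thesis using crossP[OF a] exit[OF a] that(3) contY
      by (auto intro!: in_before[of Y a "T a" P])
  qed
  have dep': "\<exists>d>0. \<forall>a'. \<bar>a' - a\<bar> < d \<longrightarrow>
        (\<forall>t\<in>{0..s}. \<bar>P a' t - P a t\<bar> < e \<and> \<bar>Y a' t - Y a t\<bar> < e)" if "0 \<le> s" "0 < e" for a s e
    using dep[OF that, of a] by blast
  have disj: "before Y P \<inter> before P Y = {}"
  proof -
    have False if "0 \<le> s" "Y a s < 0" "\<forall>t\<in>{0..s}. 0 < P a t" "0 \<le> s'" "P a s' < 0" "\<forall>t\<in>{0..s'}. 0 < Y a t" for a s s'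
      using that by (cases "s \<le> s'") force+
    then show ?thesis unfolding before_def by blast
  qed
  have "\<not> {a1..a2} \<subseteq> before Y P \<union> before P Y"
  proof
    assume "{a1..a2} \<subseteq> before Y P \<union> before P Y"
    moreover have "a1 \<in> before Y P \<inter> {a1..a2}" "a2 \<in> before P Y \<inter> {a1..a2}"
      using YP[of a1] PY[of a2] left right le by auto
    ultimately show False
      using connectedD[OF connected_Icc open_before[OF contP dep] open_before[OF contY dep'], of a1 a2] disj
      by blast
  qed
  then obtain a where "a \<in> {a1..a2}" "a \<notin> before Y P \<union> before P Y" by blast
  then have a: "a1 \<le> a" "a \<le> a2" "a \<notin> before Y P" "a \<notin> before P Y" by auto
  have "min (Y a (T a)) (P a (T a)) = 0" using exit[OF a(1,2)] by simp
  moreover have "\<not> 0 < P a (T a)" "\<not> 0 < Y a (T a)" using YP PY a by auto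
  ultimately have "Y a (T a) = 0" "P a (T a) = 0" by (auto simp: min_def split: if_splits)
  then show thesis using that a(1,2) by blast
qed

section \<open>Bounded Lipschitz functions\<close>

text \<open>Lipschitz functions are not closed under products, bounded ones are; this is what a polynomial
  vector field in clamped variables needs.\<close>

definition bounded_lipschitz :: "('a::metric_space \<Rightarrow> real) \<Rightarrow> bool" where
  "bounded_lipschitz f \<longleftrightarrow> bounded (range f) \<and> (\<exists>L. L-lipschitz_on UNIV f)"

lemma bounded_lipschitz_const: "bounded_lipschitz (\<lambda>_. b)"
  unfolding bounded_lipschitz_def by (auto simp: image_def intro: lipschitz_on_constant)

lemma bounded_lipschitz_add:
  assumes "bounded_lipschitz f" "bounded_lipschitz g"
  shows "bounded_lipschitz (\<lambda>z. f z + g z)"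
  using assms unfolding bounded_lipschitz_def
  by (auto intro: bounded_plus_comp lipschitz_on_add)

lemma bounded_lipschitz_mult:
  assumes "bounded_lipschitz f" "bounded_lipschitz g"
  shows "bounded_lipschitz (\<lambda>z. f z * g z)"
proof -
  obtain B B' where B: "\<And>z. \<bar>f z\<bar> \<le> B" and B': "\<And>z. \<bar>g z\<bar> \<le> B'"
    using assms unfolding bounded_lipschitz_def bounded_iff by auto
  obtain L L' where L: "L-lipschitz_on UNIV f" and L': "L'-lipschitz_on UNIV g"
    using assms unfolding bounded_lipschitz_def by auto
  have nn: "0 \<le> B" "0 \<le> B'" "0 \<le> L" "0 \<le> L'"
    using order_trans[OF abs_ge_zero B] order_trans[OF abs_ge_zero B'] L L' lipschitz_on_nonneg by blast+
  have "bounded (range (\<lambda>z. f z * g z))"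
    unfolding bounded_iff using B B' nn(1)
    by (intro exI[of _ "B * B'"]) (auto simp: abs_mult intro!: mult_mono)
  moreover have "(B * L' + L * B')-lipschitz_on UNIV (\<lambda>z. f z * g z)"
  proof (rule lipschitz_onI)
    fix u v
    have "dist (f u * g u) (f v * g v) = \<bar>f u * (g u - g v) + (f u - f v) * g v\<bar>"
      by (simp add: dist_real_def algebra_simps)
    also have "\<dots> \<le> \<bar>f u\<bar> * \<bar>g u - g v\<bar> + \<bar>f u - f v\<bar> * \<bar>g v\<bar>"
      by (metis abs_mult abs_triangle_ineq)
    also have "\<dots> \<le> B * (L' * dist u v) + (L * dist u v) * B'"
      using B[of u] B'[of v] nn lipschitz_onD[OF L, of u v] lipschitz_onD[OF L', of u v]
      by (intro add_mono mult_mono) (auto simp: dist_real_def)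
    finally show "dist (f u * g u) (f v * g v) \<le> (B * L' + L * B') * dist u v"
      by (simp add: algebra_simps)
  qed (use nn in simp)
  ultimately show ?thesis unfolding bounded_lipschitz_def by blast
qed

lemma bounded_lipschitz_compose:
  fixes g :: "real \<Rightarrow> real"
  assumes f: "bounded_lipschitz f" and S: "\<And>z. f z \<in> S" and g: "L-lipschitz_on S g"
  shows "bounded_lipschitz (\<lambda>z. g (f z))"
proof -
  obtain K where K: "K-lipschitz_on UNIV f" using f unfolding bounded_lipschitz_def by auto
  have "L-lipschitz_on (range f) g" using g by (rule lipschitz_on_subset) (use S in auto)
  then have "(L * K)-lipschitz_on UNIV (\<lambda>z. g (f z))"
    using lipschitz_on_compose2[OF K] by blast
  moreover have "bounded (g ` range f)"
  proof -
    have "L-lipschitz_on (range f) g" by fact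
    moreover have "bounded (range f)" using f unfolding bounded_lipschitz_def by auto
    ultimately show ?thesis
      by (meson bounded_uniformly_continuous_image lipschitz_on_uniformly_continuous)
  qed
  ultimately show ?thesis unfolding bounded_lipschitz_def by (auto simp: image_image)
qed

lemma bounded_lipschitz_power:
  "bounded_lipschitz f \<Longrightarrow> bounded_lipschitz (\<lambda>z. f z ^ n)"
  by (induction n) (auto intro: bounded_lipschitz_const bounded_lipschitz_mult)

text \<open>Cutting off at \<open>\<delta>\<close> removes the singularity of the Newtonian potential.\<close>

lemma lipschitz_inverse_sqrt_max:
  assumes "0 < \<delta>"
  shows "(1 / (2 * sqrt \<delta> ^ 3))-lipschitz_on UNIV (\<lambda>u. inverse (sqrt (max \<delta> u)))"
proof (rule lipschitz_onI)
  fix u v :: real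
  define s t where "s = sqrt (max \<delta> u)" and "t = sqrt (max \<delta> v)"
  have st: "sqrt \<delta> \<le> s" "sqrt \<delta> \<le> t" "0 < sqrt \<delta>" using assms by (auto simp: s_def t_def)
  then have pos: "0 < s" "0 < t" by linarith+
  have "t\<^sup>2 - s\<^sup>2 = max \<delta> v - max \<delta> u" using assms by (simp add: s_def t_def)
  then have sq: "\<bar>t\<^sup>2 - s\<^sup>2\<bar> \<le> \<bar>u - v\<bar>" by linarith
  have "sqrt \<delta> * sqrt \<delta> \<le> s * t" using st pos by (intro mult_mono) auto
  then have "(sqrt \<delta> * sqrt \<delta>) * (2 * sqrt \<delta>) \<le> (s * t) * (s + t)"
    using st pos by (intro mult_mono) auto
  then have den: "2 * sqrt \<delta> ^ 3 \<le> (s * t) * (s + t)" by (simp add: power3_eq_cube mult_ac)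
  have "inverse s - inverse t = (t\<^sup>2 - s\<^sup>2) / ((s * t) * (s + t))"
  proof -
    have "t\<^sup>2 - s\<^sup>2 = (t - s) * (s + t)" by (simp add: power2_eq_square algebra_simps)
    moreover have "inverse s - inverse t = (t - s) / (s * t)" using pos by (simp add: field_simps)
    ultimately show ?thesis using pos by simp
  qed
  then have "\<bar>inverse s - inverse t\<bar> = \<bar>t\<^sup>2 - s\<^sup>2\<bar> / ((s * t) * (s + t))"
    using pos by (simp add: abs_mult)
  also have "\<dots> \<le> \<bar>u - v\<bar> / (2 * sqrt \<delta> ^ 3)"
    using sq den st by (intro frac_le) auto
  finally show "dist (inverse (sqrt (max \<delta> u))) (inverse (sqrt (max \<delta> v))) \<le> 1 / (2 * sqrt \<delta> ^ 3) * dist u v"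
    by (simp add: dist_real_def s_def t_def)
qed (use assms in simp)

lemma bounded_lipschitz_quadruple:
  assumes "bounded_lipschitz f1" "bounded_lipschitz f2" "bounded_lipschitz f3" "bounded_lipschitz f4"
  obtains L where "L-lipschitz_on UNIV (\<lambda>z. (f1 z, f2 z, f3 z, f4 z))"
proof -
  obtain L1 L2 L3 L4 where "L1-lipschitz_on UNIV f1" "L2-lipschitz_on UNIV f2"
    "L3-lipschitz_on UNIV f3" "L4-lipschitz_on UNIV f4"
    using assms unfolding bounded_lipschitz_def by blast
  from lipschitz_on_Pair[OF this(1) lipschitz_on_Pair[OF this(2) lipschitz_on_Pair[OF this(3,4)]]]
  show thesis by (rule that)
qed

definition clamp_at :: "real \<Rightarrow> real \<Rightarrow> real" where
  "clamp_at M u = max (- M) (min M u)"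

lemma clamp_at_id: "\<bar>u\<bar> \<le> M \<Longrightarrow> clamp_at M u = u"
  and clamp_at_minus: "0 \<le> M \<Longrightarrow> clamp_at M (- u) = - clamp_at M u"
  by (auto simp: clamp_at_def)

lemma bounded_lipschitz_clamp:
  fixes f :: "'a::metric_space \<Rightarrow> real"
  assumes "0 \<le> M" "1-lipschitz_on UNIV f"
  shows "bounded_lipschitz (\<lambda>z. clamp_at M (f z))"
proof -
  have "bounded (range (\<lambda>z. clamp_at M (f z)))"
    unfolding bounded_iff using assms(1) by (intro exI[of _ M]) (auto simp: clamp_at_def)
  moreover have "1-lipschitz_on UNIV (clamp_at M)"
    by (rule lipschitz_onI) (auto simp: clamp_at_def dist_real_def)
  then have "(1 * 1)-lipschitz_on UNIV (\<lambda>z. clamp_at M (f z))"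
    using assms(2) by (intro lipschitz_on_compose2) (auto intro: lipschitz_on_subset)
  ultimately show ?thesis unfolding bounded_lipschitz_def by auto
qed

lemma lipschitz_1_compose:
  "1-lipschitz_on UNIV f \<Longrightarrow> 1-lipschitz_on UNIV g \<Longrightarrow> 1-lipschitz_on UNIV (\<lambda>z. g (f z))"
  using lipschitz_on_compose2[of 1 UNIV f 1 g] lipschitz_on_subset[of 1 UNIV g "range f"] by simp

lemma lipschitz_fst_snd:
  "1-lipschitz_on UNIV fst" "1-lipschitz_on UNIV snd"
  by (rule lipschitz_onI; simp add: dist_fst_le dist_snd_le)+

section \<open>A priori estimates for the reduced equations\<close>

locale isosceles =
  fixes m1 m2 E :: real
  assumes m1: "m1 > 0" and m2: "m2 > 0" and E: "E < 0"
begin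

text \<open>On the slice both radicands equal \<open>rad x y\<close>, and \<open>\<Gamma>\<close> reads
  \<open>p\<^sup>2 / (4 m1) + c q\<^sup>2 x\<^sup>2 - 2 k x\<^sup>2 / sqrt (rad x y) - m1\<^sup>2 - E x\<^sup>2\<close>. The constant \<open>h\<close> is the bound that
  \<open>\<Gamma> = 0\<close> gives for the terms that are quadratic in the momenta.\<close>

definition "c = 1 / m1 + 2 / m2"
definition "k = m1 * m2"
definition "\<mu> = mu m1 m2"
definition "rad x y = x ^ 4 / 4 + \<mu>\<^sup>2 * y\<^sup>2"
definition "h = 4 * k + m1\<^sup>2"

text \<open>The reduced vector field, with \<open>w\<close> in place of \<open>1 / r\<^sup>3\<close>, where \<open>r\<close> is the distance of either body of
  mass \<open>m1\<close> to the body of mass \<open>m2\<close>. The true and the truncated field differ in \<open>w\<close> only, apart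
  from the clamping of the arguments.\<close>

definition vf :: "real \<Rightarrow> real \<Rightarrow> real \<Rightarrow> real \<Rightarrow> real \<Rightarrow> real \<times> real \<times> real \<times> real" where
  "vf w x y p q = (p / (2 * m1), 2 * c * x\<^sup>2 * q,
     x * (- 2 * c * q\<^sup>2 + 4 * k * \<mu>\<^sup>2 * y\<^sup>2 * w + 2 * E), - 2 * k * \<mu>\<^sup>2 * x\<^sup>2 * y * w)"

lemma c_pos: "c > 0" and k_pos: "k > 0" and mu_pos: "\<mu> > 0" and h_pos: "h > 0"
  using m1 m2 by (auto simp: c_def k_def \<mu>_def mu_def h_def add_pos_pos)

lemma rad_nonneg: "0 \<le> rad x y"
  by (simp add: rad_def)

lemma sqrt_rad_ge: "x\<^sup>2 / 2 \<le> sqrt (rad x y)" "\<mu> * y \<le> sqrt (rad x y)"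
  by (rule real_le_rsqrt; simp add: rad_def power_divide power_mult_distrib flip: power_mult)+

end

text \<open>A solution of the reduced equations that starts at the binary collision with height \<open>a\<close> and remains
  in the closed quadrant \<open>y \<ge> 0, p \<ge> 0\<close> up to time \<open>T\<close>. The momentum \<open>2 m1 powr (3/2)\<close> is forced by the
  condition \<open>\<Gamma> = 0\<close> at \<open>x = 0\<close>. Derivatives are two-sided also at the ends, since arcs are cut out of
  solutions defined on the whole line.\<close>

locale quadrant_arc = isosceles +
  fixes a T :: real and x y p q :: "real \<Rightarrow> real"
  assumes a: "0 < a" and T: "0 \<le> T"
    and x0: "x 0 = 0" and y0: "y 0 = a" and p0: "p 0 = 2 * m1 powr (3 / 2)" and q0: "q 0 = 0"
    and rad_pos: "\<lbrakk>0 \<le> s; s \<le> T\<rbrakk> \<Longrightarrow> rad (x s) (y s) > 0"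
    and dx: "\<lbrakk>0 \<le> s; s \<le> T\<rbrakk> \<Longrightarrow> (x has_real_derivative p s / (2 * m1)) (at s)"
    and dy: "\<lbrakk>0 \<le> s; s \<le> T\<rbrakk> \<Longrightarrow> (y has_real_derivative 2 * c * (x s)\<^sup>2 * q s) (at s)"
    and dp: "\<lbrakk>0 \<le> s; s \<le> T\<rbrakk> \<Longrightarrow> (p has_real_derivative x s * (- 2 * c * (q s)\<^sup>2
        + 4 * k * \<mu>\<^sup>2 * (y s)\<^sup>2 / sqrt (rad (x s) (y s)) ^ 3 + 2 * E)) (at s)"
    and dq: "\<lbrakk>0 \<le> s; s \<le> T\<rbrakk> \<Longrightarrow> (q has_real_derivative
        - 2 * k * \<mu>\<^sup>2 * (x s)\<^sup>2 * y s / sqrt (rad (x s) (y s)) ^ 3) (at s)"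
    and y_nonneg: "\<lbrakk>0 \<le> s; s \<le> T\<rbrakk> \<Longrightarrow> 0 \<le> y s"
    and p_nonneg: "\<lbrakk>0 \<le> s; s \<le> T\<rbrakk> \<Longrightarrow> 0 \<le> p s"
begin

abbreviation "r s \<equiv> sqrt (rad (x s) (y s))"

lemma r_pos: "\<lbrakk>0 \<le> s; s \<le> T\<rbrakk> \<Longrightarrow> 0 < r s"
  using rad_pos by simp

lemma r_sq: "(r s)\<^sup>2 = rad (x s) (y s)"
  by (simp add: rad_nonneg)

lemma x_mono: "\<lbrakk>0 \<le> s; s \<le> t; t \<le> T\<rbrakk> \<Longrightarrow> x s \<le> x t"
proof (rule DERIV_nonneg_imp_nondecreasing[of s t x])
  fix u assume "0 \<le> s" "t \<le> T" "s \<le> u" "u \<le> t"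
  then show "\<exists>d. (x has_real_derivative d) (at u) \<and> 0 \<le> d"
    using dx[of u] p_nonneg[of u] m1 by (intro exI[of _ "p u / (2 * m1)"]) simp
qed

lemma x_nonneg: "\<lbrakk>0 \<le> s; s \<le> T\<rbrakk> \<Longrightarrow> 0 \<le> x s"
  using x_mono[of 0 s] x0 by simp

lemma q_antimono: "\<lbrakk>0 \<le> s; s \<le> t; t \<le> T\<rbrakk> \<Longrightarrow> q t \<le> q s"
proof (rule DERIV_nonpos_imp_nonincreasing[of s t q])
  fix u assume "0 \<le> s" "t \<le> T" "s \<le> u" "u \<le> t"
  then have u: "0 \<le> u" "u \<le> T" by auto
  show "\<exists>d. (q has_real_derivative d) (at u) \<and> d \<le> 0"
    using dq[OF u] r_pos[OF u] y_nonneg[OF u] k_pos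
    by (intro exI[of _ "- 2 * k * \<mu>\<^sup>2 * (x u)\<^sup>2 * y u / r u ^ 3"]) simp
qed

lemma q_nonpos: "\<lbrakk>0 \<le> s; s \<le> T\<rbrakk> \<Longrightarrow> q s \<le> 0"
  using q_antimono[of 0 s] q0 by simp

lemma y_antimono: "\<lbrakk>0 \<le> s; s \<le> t; t \<le> T\<rbrakk> \<Longrightarrow> y t \<le> y s"
proof (rule DERIV_nonpos_imp_nonincreasing[of s t y])
  fix u assume "0 \<le> s" "t \<le> T" "s \<le> u" "u \<le> t"
  then have u: "0 \<le> u" "u \<le> T" by auto
  show "\<exists>d. (y has_real_derivative d) (at u) \<and> d \<le> 0"
    using dy[OF u] q_nonpos[OF u] c_pos
    by (intro exI[of _ "2 * c * (x u)\<^sup>2 * q u"]) (simp add: mult_nonneg_nonpos)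
qed

lemma y_le: "\<lbrakk>0 \<le> s; s \<le> T\<rbrakk> \<Longrightarrow> y s \<le> a"
  using y_antimono[of 0 s] y0 by simp

lemma dr:
  assumes s: "0 \<le> s" "s \<le> T"
  shows "(r has_real_derivative
    ((x s) ^ 3 * (p s / (2 * m1)) + 2 * \<mu>\<^sup>2 * y s * (2 * c * (x s)\<^sup>2 * q s)) / (2 * r s)) (at s)"
proof -
  have "((\<lambda>s. rad (x s) (y s)) has_real_derivative
     ((x s) ^ 3 * (p s / (2 * m1)) + 2 * \<mu>\<^sup>2 * y s * (2 * c * (x s)\<^sup>2 * q s))) (at s)"
    unfolding rad_def by (rule derivative_eq_intros dx[OF s] dy[OF s] refl | simp)+
  from DERIV_chain2[OF DERIV_real_sqrt[OF rad_pos[OF s]] this]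
  show ?thesis by (simp add: field_simps)
qed

text \<open>Conservation of \<open>\<Gamma>\<close>; its value is fixed by the initial momentum.\<close>

lemma energy:
  assumes s: "0 \<le> s" "s \<le> T"
  shows "(p s)\<^sup>2 / (4 * m1) + c * (q s)\<^sup>2 * (x s)\<^sup>2 = 2 * k * (x s)\<^sup>2 / r s + m1\<^sup>2 + E * (x s)\<^sup>2"
proof -
  define H where "H s = (p s)\<^sup>2 / (4 * m1) + c * (q s)\<^sup>2 * (x s)\<^sup>2 - 2 * k * (x s)\<^sup>2 / r s - E * (x s)\<^sup>2" for s
  have dH: "(H has_real_derivative 0) (at t)" if t: "0 \<le> t" "t \<le> T" for t
  proof -
    define X Y P Q R dX dY dP dQ dR where "X = x t" and "Y = y t" and "P = p t" and "Q = q t" and "R = r t"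
      and "dX = P / (2 * m1)" and "dY = 2 * c * X\<^sup>2 * Q"
      and "dP = X * (- 2 * c * Q\<^sup>2 + 4 * k * \<mu>\<^sup>2 * Y\<^sup>2 / R ^ 3 + 2 * E)"
      and "dQ = - 2 * k * \<mu>\<^sup>2 * X\<^sup>2 * Y / R ^ 3" and "dR = (X ^ 3 * dX + 2 * \<mu>\<^sup>2 * Y * dY) / (2 * R)"
    note defs = this
    have R: "R > 0" using r_pos[OF t] by (simp add: defs)
    have R2: "R\<^sup>2 = X ^ 4 / 4 + \<mu>\<^sup>2 * Y\<^sup>2" using r_sq[of t] by (simp add: defs rad_def)
    have "((\<lambda>s. (p s)\<^sup>2 / (4 * m1)) has_real_derivative dX * dP) (at t)"
      unfolding defs by (rule DERIV_cong[OF DERIV_cdivide[OF DERIV_power[OF dp[OF t], of 2], of "4 * m1"]]) simp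
    moreover have "((\<lambda>s. c * (q s)\<^sup>2 * (x s)\<^sup>2) has_real_derivative dY * dQ + 2 * c * Q\<^sup>2 * X * dX) (at t)"
      unfolding defs by (rule derivative_eq_intros dx[OF t] dq[OF t] refl)+ (simp add: mult_ac)
    moreover have "((\<lambda>s. 2 * k * (x s)\<^sup>2 / r s) has_real_derivative
        ((2 * k * (2 * X * dX)) * R - 2 * k * X\<^sup>2 * dR) / (R * R)) (at t)"
    proof (rule DERIV_divide[where f = "\<lambda>s. 2 * k * (x s)\<^sup>2" and g = r and x = t, folded R_def X_def])
      show "((\<lambda>s. 2 * k * (x s)\<^sup>2) has_real_derivative 2 * k * (2 * X * dX)) (at t)"
        unfolding defs by (rule derivative_eq_intros dx[OF t] refl)+ simp
      show "(r has_real_derivative dR) (at t)"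
        unfolding defs by (rule dr[OF t])
    qed (use R in simp)
    moreover have "((\<lambda>s. E * (x s)\<^sup>2) has_real_derivative 2 * E * X * dX) (at t)"
      unfolding defs by (rule derivative_eq_intros dx[OF t] refl)+ simp
    ultimately have "(H has_real_derivative dX * dP + (dY * dQ + 2 * c * Q\<^sup>2 * X * dX)
       - ((2 * k * (2 * X * dX)) * R - 2 * k * X\<^sup>2 * dR) / (R * R) - 2 * E * X * dX) (at t)"
      unfolding H_def by (intro DERIV_diff DERIV_add)
    moreover have "((2 * k * (2 * X * dX)) * R - 2 * k * X\<^sup>2 * dR) / (R * R)
        = dX * X * (4 * k * \<mu>\<^sup>2 * Y\<^sup>2 / R ^ 3) - 2 * k * X\<^sup>2 * \<mu>\<^sup>2 * Y * dY / R ^ 3"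
    proof -
      have "((2 * k * (2 * X * dX)) * R - 2 * k * X\<^sup>2 * dR) / (R * R)
        = (4 * k * X * dX * R\<^sup>2 - k * X\<^sup>2 * (X ^ 3 * dX + 2 * \<mu>\<^sup>2 * Y * dY)) / R ^ 3"
        unfolding \<open>dR = _\<close> using R by (simp add: field_simps power3_eq_cube power2_eq_square)
      also have "\<dots> = (4 * k * X * dX * (\<mu>\<^sup>2 * Y\<^sup>2) - k * X\<^sup>2 * 2 * \<mu>\<^sup>2 * Y * dY) / R ^ 3"
        by (rule arg_cong[where f = "\<lambda>v. v / R ^ 3"], unfold R2)
          (simp add: algebra_simps power2_eq_square power3_eq_cube power4_eq_xxxx)
      finally show ?thesis by (simp add: diff_divide_distrib mult_ac)
    qed
    ultimately show ?thesis
      unfolding \<open>dP = _\<close> \<open>dQ = _\<close> by (simp add: algebra_simps power2_eq_square)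
  qed
  have "H s = H 0"
  proof (cases "s = 0")
    case False
    show ?thesis
    proof (rule DERIV_isconst_end[of 0 s H])
      show "continuous_on {0..s} H"
        using s by (auto intro!: continuous_at_imp_continuous_on DERIV_isCont[OF dH])
    qed (use False s dH in auto)
  qed simp
  also have "H 0 = m1\<^sup>2"
  proof -
    have "(m1 powr (3 / 2))\<^sup>2 = m1 ^ 3"
      using m1 by (simp add: powr_powr flip: powr_numeral)
    then show ?thesis
      using m1 by (simp add: H_def x0 p0 power_mult_distrib power2_eq_square power3_eq_cube)
  qed
  finally show ?thesis by (simp add: H_def)
qed

text \<open>As \<open>r \<ge> x\<^sup>2 / 2\<close>, the potential term is bounded even near the triple collision; this is the effect of
  the regularising time change. For \<open>E < 0\<close> the term \<open>E x\<^sup>2\<close> joins the kinetic terms with a positive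
  sign, so that the bound limits \<open>x\<close> as well.\<close>

lemma energy_bound:
  assumes s: "0 \<le> s" "s \<le> T"
  shows "(p s)\<^sup>2 / (4 * m1) + c * (q s)\<^sup>2 * (x s)\<^sup>2 + \<bar>E\<bar> * (x s)\<^sup>2 \<le> h"
proof -
  have "(x s)\<^sup>2 / r s \<le> 2"
    using sqrt_rad_ge(1)[of "x s" "y s"] r_pos[OF s] by (simp add: divide_le_eq)
  then have "2 * k * ((x s)\<^sup>2 / r s) \<le> 2 * k * 2" using k_pos by (intro mult_left_mono) auto
  then show ?thesis using energy[OF s] E by (simp add: h_def)
qed

lemma p_bound:
  assumes s: "0 \<le> s" "s \<le> T"
  shows "(p s)\<^sup>2 \<le> 4 * m1 * h"
proof -
  have "0 \<le> c * (q s)\<^sup>2 * (x s)\<^sup>2" "0 \<le> \<bar>E\<bar> * (x s)\<^sup>2" using c_pos by auto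
  then have "(p s)\<^sup>2 / (4 * m1) \<le> h" using energy_bound[OF s] by linarith
  then show ?thesis using m1 by (simp add: field_simps)
qed

lemma x_bound:
  assumes s: "0 \<le> s" "s \<le> T"
  shows "(x s)\<^sup>2 \<le> h / \<bar>E\<bar>"
proof -
  have "0 \<le> c * (q s)\<^sup>2 * (x s)\<^sup>2" "0 \<le> (p s)\<^sup>2 / (4 * m1)" using c_pos m1 by auto
  then have "\<bar>E\<bar> * (x s)\<^sup>2 \<le> h" using energy_bound[OF s] by linarith
  then show ?thesis using E by (simp add: field_simps)
qed

lemma q_energy_bound:
  assumes s: "0 \<le> s" "s \<le> T"
  shows "c * (q s)\<^sup>2 * (x s)\<^sup>2 \<le> h"
proof -
  have "0 \<le> \<bar>E\<bar> * (x s)\<^sup>2" "0 \<le> (p s)\<^sup>2 / (4 * m1)" using m1 by auto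
  then show ?thesis using energy_bound[OF s] by linarith
qed

lemma x_le_linear:
  assumes s: "0 \<le> s" "s \<le> T"
  shows "x s \<le> sqrt (h / m1) * s"
proof -
  have "x s - sqrt (h / m1) * s \<le> x 0 - sqrt (h / m1) * 0"
  proof (rule DERIV_nonpos_imp_nonincreasing[OF s(1)])
    fix u assume u: "0 \<le> u" "u \<le> s"
    have "p u \<le> sqrt (4 * m1 * h)"
      using p_bound[of u] u s by (intro real_le_rsqrt) auto
    also have "\<dots> = 2 * m1 * sqrt (h / m1)"
    proof -
      have "4 * m1 * h = (2 * m1)\<^sup>2 * (h / m1)" using m1 by (simp add: power2_eq_square)
      then have "sqrt (4 * m1 * h) = sqrt ((2 * m1)\<^sup>2 * (h / m1))" by simp
      also have "\<dots> = sqrt ((2 * m1)\<^sup>2) * sqrt (h / m1)" by (rule real_sqrt_mult)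
      finally show ?thesis unfolding real_sqrt_abs using m1 by simp
    qed
    finally have "p u / (2 * m1) - sqrt (h / m1) \<le> 0" using m1 by (simp add: field_simps)
    moreover have "((\<lambda>s. x s - sqrt (h / m1) * s) has_real_derivative p u / (2 * m1) - sqrt (h / m1)) (at u)"
      using u s by (auto intro!: derivative_eq_intros dx)
    ultimately show "\<exists>d. ((\<lambda>s. x s - sqrt (h / m1) * s) has_real_derivative d) (at u) \<and> d \<le> 0" by blast
  qed
  then show ?thesis using x0 by simp
qed

text \<open>The Lagrange-Jacobi argument. The derivative of the generator of dilations \<open>x p / 2 + y q\<close> is
  \<open>m1\<^sup>2 + 2 x\<^sup>2 (m1 m2 / r + E)\<close>, hence at least \<open>m1\<^sup>2 / 2\<close> as long as \<open>x\<close> is small, and \<open>y q \<le> 0\<close>.\<close>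

lemma expansion:
  assumes s: "0 \<le> s" "s \<le> T" and small: "4 * \<bar>E\<bar> * (x s)\<^sup>2 \<le> m1\<^sup>2"
  shows "m1\<^sup>2 * s \<le> x s * p s"
proof -
  \<comment> \<open>The generator of dilations, minus the growth that is to be shown.\<close>
  define G where "G u = x u * p u / 2 + y u * q u - m1\<^sup>2 / 2 * u" for u
  have "G 0 \<le> G s"
  proof (rule DERIV_nonneg_imp_nondecreasing[OF s(1)])
    fix u assume u: "0 \<le> u" "u \<le> s"
    then have uT: "0 \<le> u" "u \<le> T" using s by auto
    have "(G has_real_derivative (p u)\<^sup>2 / (4 * m1) + c * (q u)\<^sup>2 * (x u)\<^sup>2 + E * (x u)\<^sup>2 - m1\<^sup>2 / 2) (at u)"
      unfolding G_def
      by (rule DERIV_cong[OF DERIV_diff[OF DERIV_add[OF DERIV_cdivide[OF DERIV_mult[OF dx[OF uT] dp[OF uT]]]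
              DERIV_mult[OF dy[OF uT] dq[OF uT]]] DERIV_cmult_Id]])
        (simp add: algebra_simps power2_eq_square add_divide_distrib diff_divide_distrib)
    moreover have "0 \<le> (p u)\<^sup>2 / (4 * m1) + c * (q u)\<^sup>2 * (x u)\<^sup>2 + E * (x u)\<^sup>2 - m1\<^sup>2 / 2"
    proof -
      have "(x u)\<^sup>2 \<le> (x s)\<^sup>2"
        using x_mono[of u s] x_nonneg[of u] u s by (intro power_mono) auto
      then have "4 * \<bar>E\<bar> * (x u)\<^sup>2 \<le> m1\<^sup>2"
        using small by (meson abs_ge_zero mult_left_mono mult_nonneg_nonneg order_trans zero_le_numeral)
      moreover have "0 \<le> 2 * k * (x u)\<^sup>2 / r u" using k_pos r_pos[OF uT] by simp
      ultimately show ?thesis using energy[OF uT] E by simp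
    qed
    ultimately show "\<exists>d. (G has_real_derivative d) (at u) \<and> 0 \<le> d" by blast
  qed
  moreover have "y s * q s \<le> 0" using y_nonneg[OF s] q_nonpos[OF s] by (rule mult_nonneg_nonpos)
  ultimately show ?thesis by (simp add: G_def x0 q0)
qed

text \<open>Integrates the previous bound, using \<open>(x\<^sup>2)' = x p / m1\<close>.\<close>

lemma x_ge_linear:
  assumes s: "0 \<le> s" "s \<le> T" and small: "4 * \<bar>E\<bar> * (x s)\<^sup>2 \<le> m1\<^sup>2"
  shows "m1 / 2 * s\<^sup>2 \<le> (x s)\<^sup>2"
proof -
  have "(x 0)\<^sup>2 - m1 / 2 * 0\<^sup>2 \<le> (x s)\<^sup>2 - m1 / 2 * s\<^sup>2"
  proof (rule DERIV_nonneg_imp_nondecreasing[OF s(1)])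
    fix u assume u: "0 \<le> u" "u \<le> s"
    then have uT: "0 \<le> u" "u \<le> T" using s by auto
    have "(x u)\<^sup>2 \<le> (x s)\<^sup>2"
      using x_mono[of u s] x_nonneg[of u] u s by (intro power_mono) auto
    then have "4 * \<bar>E\<bar> * (x u)\<^sup>2 \<le> m1\<^sup>2"
      using small by (meson abs_ge_zero mult_left_mono mult_nonneg_nonneg order_trans zero_le_numeral)
    from expansion[OF uT this] have "0 \<le> x u * p u / m1 - m1 * u"
      using m1 by (simp add: field_simps power2_eq_square)
    moreover have "((\<lambda>s. (x s)\<^sup>2 - m1 / 2 * s\<^sup>2) has_real_derivative x u * p u / m1 - m1 * u) (at u)"
      by (rule derivative_eq_intros dx[OF uT] refl)+ simp
    ultimately show "\<exists>d. ((\<lambda>s. (x s)\<^sup>2 - m1 / 2 * s\<^sup>2) has_real_derivative d) (at u) \<and> 0 \<le> d" by blast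
  qed
  then show ?thesis using x0 by simp
qed

lemma x_pos:
  assumes s: "0 < s" "s \<le> T"
  shows "0 < x s"
proof (rule ccontr)
  assume "\<not> 0 < x s"
  then have "x s = 0" using x_nonneg[of s] s by simp
  then have "m1 / 2 * s\<^sup>2 \<le> 0" using x_ge_linear[of s] s m1 by simp
  then show False using m1 s by (simp add: mult_le_0_iff)
qed

lemma inv_cube_bound: "\<lbrakk>0 \<le> s; s \<le> T; y s \<ge> a / 2\<rbrakk> \<Longrightarrow> \<mu>\<^sup>2 * y s / r s ^ 3 \<le> 4 / (\<mu> * a\<^sup>2)"
proof -
  assume s: "0 \<le> s" "s \<le> T" and ya: "y s \<ge> a / 2"
  have y: "0 < y s" using ya a by linarith
  have "(\<mu> * y s) ^ 3 \<le> r s ^ 3"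
    using sqrt_rad_ge(2) mu_pos y by (intro power_mono) auto
  then have "\<mu>\<^sup>2 * y s / r s ^ 3 \<le> \<mu>\<^sup>2 * y s / (\<mu> * y s) ^ 3"
    using mu_pos y by (intro divide_left_mono) (auto intro!: mult_pos_pos zero_less_power r_pos s)
  also have "\<dots> = 1 / (\<mu> * (y s)\<^sup>2)"
    using mu_pos y by (simp add: field_simps power2_eq_square power3_eq_cube)
  also have "\<dots> \<le> 1 / (\<mu> * (a / 2)\<^sup>2)"
    using mu_pos y a ya by (intro divide_left_mono mult_left_mono power_mono) auto
  finally show ?thesis by (simp add: power_divide)
qed

text \<open>While the bodies are far apart the force on the outer body is at most of order \<open>x\<^sup>2 / a\<^sup>2\<close>.\<close>

lemma q_ge:
  assumes s: "0 \<le> s" "s \<le> T" and ys: "y s \<ge> a / 2"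
  shows "- (8 * k / (\<mu> * a\<^sup>2)) * (x s)\<^sup>2 * s \<le> q s"
proof -
  define b where "b = 8 * k / (\<mu> * a\<^sup>2) * (x s)\<^sup>2"
  have "q 0 + b * 0 \<le> q s + b * s"
  proof (rule DERIV_nonneg_imp_nondecreasing[OF s(1)])
    fix u assume u: "0 \<le> u" "u \<le> s"
    then have uT: "0 \<le> u" "u \<le> T" using s by auto
    have "y u \<ge> a / 2" using y_antimono[of u s] u s ys by simp
    from inv_cube_bound[OF uT this]
    have "2 * k * (x u)\<^sup>2 * (\<mu>\<^sup>2 * y u / r u ^ 3) \<le> 2 * k * (x u)\<^sup>2 * (4 / (\<mu> * a\<^sup>2))"
      using k_pos by (intro mult_left_mono) auto
    also have "\<dots> \<le> 2 * k * (x s)\<^sup>2 * (4 / (\<mu> * a\<^sup>2))"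
      using x_mono[of u s] x_nonneg[of u] u s k_pos mu_pos
      by (intro mult_right_mono mult_left_mono power_mono) auto
    finally have "0 \<le> - 2 * k * \<mu>\<^sup>2 * (x u)\<^sup>2 * y u / r u ^ 3 + b"
      by (simp add: b_def mult_ac)
    moreover have "((\<lambda>s. q s + b * s) has_real_derivative
        - 2 * k * \<mu>\<^sup>2 * (x u)\<^sup>2 * y u / r u ^ 3 + b) (at u)"
      by (rule derivative_eq_intros dq[OF uT] refl)+ simp
    ultimately show "\<exists>d. ((\<lambda>s. q s + b * s) has_real_derivative d) (at u) \<and> 0 \<le> d" by blast
  qed
  then show ?thesis by (simp add: b_def q0)
qed

text \<open>Both \<open>x\<close> and \<open>\<bar>q\<bar>\<close> increase, so \<open>y'\<close> is smallest at the end.\<close>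

lemma y_ge_of_q:
  assumes s: "0 \<le> s" "s \<le> T"
  shows "a + 2 * c * (x s)\<^sup>2 * q s * s \<le> y s"
proof -
  define b where "b = 2 * c * (x s)\<^sup>2 * q s"
  have "y 0 - b * 0 \<le> y s - b * s"
  proof (rule DERIV_nonneg_imp_nondecreasing[OF s(1)])
    fix u assume u: "0 \<le> u" "u \<le> s"
    then have uT: "0 \<le> u" "u \<le> T" using s by auto
    have "(x u)\<^sup>2 * (- q u) \<le> (x s)\<^sup>2 * (- q s)"
      using x_mono[of u s] x_nonneg[of u] q_antimono[of u s] q_nonpos[OF uT] u s
      by (intro mult_mono power_mono) auto
    then have "2 * c * ((x u)\<^sup>2 * (- q u)) \<le> 2 * c * ((x s)\<^sup>2 * (- q s))"
      using c_pos by (intro mult_left_mono) auto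
    then have "0 \<le> 2 * c * (x u)\<^sup>2 * q u - b"
      by (simp add: b_def mult.assoc)
    moreover have "((\<lambda>s. y s - b * s) has_real_derivative 2 * c * (x u)\<^sup>2 * q u - b) (at u)"
      by (rule derivative_eq_intros dy[OF uT] refl)+ simp
    ultimately show "\<exists>d. ((\<lambda>s. y s - b * s) has_real_derivative d) (at u) \<and> 0 \<le> d" by blast
  qed
  then show ?thesis by (simp add: b_def y0)
qed

text \<open>Descending by \<open>a / 2\<close> takes a certain impulse, and the force is bounded in terms of \<open>x\<close>.\<close>

lemma descent_needs_width:
  assumes s: "0 \<le> s" "s \<le> T" and ys: "y s < a / 2"
  obtains t where "0 \<le> t" "t \<le> s" "y t = a / 2" "\<mu> * a ^ 3 \<le> 32 * c * k * (x t) ^ 4 * t\<^sup>2"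
proof -
  have "continuous_on {0..s} y"
    by (rule continuous_at_imp_continuous_on) (use dy DERIV_isCont s in force)
  then obtain t where t: "0 \<le> t" "t \<le> s" "y t = a / 2"
    using IVT2'[of y s "a / 2" 0] y0 a ys s by auto
  have tT: "0 \<le> t" "t \<le> T" using t s by auto
  have "2 * c * (x t)\<^sup>2 * t * (- (8 * k / (\<mu> * a\<^sup>2)) * (x t)\<^sup>2 * t) \<le> 2 * c * (x t)\<^sup>2 * t * q t"
    using q_ge[OF tT] t c_pos by (intro mult_left_mono) auto
  then have "a - a / 2 \<le> 16 * c * k * (x t) ^ 4 * t\<^sup>2 / (\<mu> * a\<^sup>2)"
    using y_ge_of_q[OF tT] t(3) by (simp add: field_simps power2_eq_square power4_eq_xxxx)
  then have "\<mu> * a ^ 3 \<le> 32 * c * k * (x t) ^ 4 * t\<^sup>2"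
    using mu_pos a by (simp add: field_simps power2_eq_square power3_eq_cube)
  then show thesis using that t by blast
qed

text \<open>By \<open>x_ge_linear\<close> the time in the bound above is at most of order \<open>x\<close>. Triple collision is thereby excluded, for once \<open>y\<close> is small \<open>x\<close> is bounded below.\<close>

lemma wide_after_descent:
  assumes s: "0 \<le> s" "s \<le> T" and ys: "y s < a / 2" and small: "4 * \<bar>E\<bar> * (x s)\<^sup>2 \<le> m1\<^sup>2"
  shows "m1 * \<mu> * a ^ 3 \<le> 64 * c * k * (x s) ^ 6"
proof -
  obtain t where t: "0 \<le> t" "t \<le> s" "\<mu> * a ^ 3 \<le> 32 * c * k * (x t) ^ 4 * t\<^sup>2"
    using descent_needs_width[OF s ys] by metis
  then have tT: "0 \<le> t" "t \<le> T" using s by auto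
  have xts: "0 \<le> x t" "x t \<le> x s" using x_nonneg[OF tT] x_mono[of t s] t s by auto
  then have "(x t)\<^sup>2 \<le> (x s)\<^sup>2" by (intro power_mono) auto
  then have "4 * \<bar>E\<bar> * (x t)\<^sup>2 \<le> m1\<^sup>2"
    using small by (meson abs_ge_zero mult_left_mono mult_nonneg_nonneg order_trans zero_le_numeral)
  from x_ge_linear[OF tT this] have m: "m1 * t\<^sup>2 \<le> 2 * (x t)\<^sup>2" by simp
  have "m1 * (\<mu> * a ^ 3) \<le> m1 * (32 * c * k * (x t) ^ 4 * t\<^sup>2)"
    using t(3) m1 by (intro mult_left_mono) auto
  also have "\<dots> = 32 * c * k * (x t) ^ 4 * (m1 * t\<^sup>2)" by simp
  also have "\<dots> \<le> 32 * c * k * (x t) ^ 4 * (2 * (x t)\<^sup>2)"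
    using m c_pos k_pos by (intro mult_left_mono) auto
  also have "\<dots> = 64 * c * k * (x t) ^ 6" by (simp flip: power_add)
  also have "\<dots> \<le> 64 * c * k * (x s) ^ 6"
    using xts c_pos k_pos by (intro mult_left_mono power_mono) auto
  finally show ?thesis by simp
qed

end

context quadrant_arc begin

lemma rad_ge:
  assumes s: "0 \<le> s" "s \<le> T" and \<xi>: "0 < \<xi>" "4 * \<bar>E\<bar> * \<xi>\<^sup>2 \<le> m1\<^sup>2"
    "64 * c * k * \<xi> ^ 6 < m1 * \<mu> * a ^ 3"
  shows "a / 2 \<le> y s \<or> \<xi> \<le> x s"
proof (rule ccontr)
  assume "\<not> ?thesis"
  then have "y s < a / 2" "x s < \<xi>" by auto
  moreover have "(x s)\<^sup>2 \<le> \<xi>\<^sup>2" using x_nonneg[OF s] \<open>x s < \<xi>\<close> by (intro power_mono) auto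
  then have "4 * \<bar>E\<bar> * (x s)\<^sup>2 \<le> m1\<^sup>2"
    using \<xi>(2) by (meson abs_ge_zero mult_left_mono mult_nonneg_nonneg order_trans zero_le_numeral)
  ultimately have "m1 * \<mu> * a ^ 3 \<le> 64 * c * k * (x s) ^ 6" by (intro wide_after_descent s) auto
  also have "\<dots> \<le> 64 * c * k * \<xi> ^ 6"
    using x_nonneg[OF s] \<open>x s < \<xi>\<close> c_pos k_pos by (intro mult_left_mono power_mono) auto
  finally show False using \<xi>(3) by simp
qed

text \<open>For \<open>x \<ge> \<xi>\<close> the energy bounds \<open>q\<close>. For \<open>x < \<xi>\<close> the body is still high, and the time elapsed is at most
  of order \<open>x\<close>, so the impulse it received is bounded.\<close>

lemma q_bound:
  assumes s: "0 \<le> s" "s \<le> T" and \<xi>: "0 < \<xi>" "4 * \<bar>E\<bar> * \<xi>\<^sup>2 \<le> m1\<^sup>2"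
    "64 * c * k * \<xi> ^ 6 < m1 * \<mu> * a ^ 3"
  shows "(q s)\<^sup>2 \<le> h / (c * \<xi>\<^sup>2) + (8 * k / (\<mu> * a\<^sup>2))\<^sup>2 * (2 * \<xi> ^ 6 / m1)"
proof (cases "\<xi> \<le> x s")
  case True
  have "c * (q s)\<^sup>2 * \<xi>\<^sup>2 \<le> c * (q s)\<^sup>2 * (x s)\<^sup>2"
    using True \<xi>(1) c_pos by (intro mult_left_mono power_mono) auto
  also have "\<dots> \<le> h" by (rule q_energy_bound[OF s])
  finally have "(q s)\<^sup>2 \<le> h / (c * \<xi>\<^sup>2)" using c_pos \<xi>(1) by (simp add: field_simps)
  moreover have "0 \<le> (8 * k / (\<mu> * a\<^sup>2))\<^sup>2 * (2 * \<xi> ^ 6 / m1)" using m1 \<xi>(1) by simp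
  ultimately show ?thesis by linarith
next
  case False
  then have ys: "a / 2 \<le> y s" using rad_ge[OF s \<xi>] by simp
  have x: "0 \<le> x s" "x s \<le> \<xi>" using False x_nonneg[OF s] by auto
  then have "(x s)\<^sup>2 \<le> \<xi>\<^sup>2" by (intro power_mono)
  then have "4 * \<bar>E\<bar> * (x s)\<^sup>2 \<le> m1\<^sup>2"
    using \<xi>(2) by (meson abs_ge_zero mult_left_mono mult_nonneg_nonneg order_trans zero_le_numeral)
  from x_ge_linear[OF s this] have m: "s\<^sup>2 \<le> 2 * (x s)\<^sup>2 / m1" using m1 by (simp add: field_simps)
  define C where "C = 8 * k / (\<mu> * a\<^sup>2)"
  have C: "0 \<le> C" using k_pos mu_pos by (simp add: C_def)
  have "(q s)\<^sup>2 \<le> (C * (x s)\<^sup>2 * s)\<^sup>2"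
    using q_ge[OF s ys, folded C_def] q_nonpos[OF s] s C
    by (intro abs_le_square_iff[THEN iffD1]) (simp add: abs_mult)
  also have "\<dots> = C\<^sup>2 * (x s) ^ 4 * s\<^sup>2" by (simp add: power_mult_distrib flip: power_mult)
  also have "\<dots> \<le> C\<^sup>2 * (x s) ^ 4 * (2 * (x s)\<^sup>2 / m1)" using m by (intro mult_left_mono) auto
  also have "\<dots> = C\<^sup>2 * (2 * (x s) ^ 6 / m1)" by (simp flip: power_add)
  also have "\<dots> \<le> C\<^sup>2 * (2 * \<xi> ^ 6 / m1)"
    using x m1 by (intro mult_left_mono divide_right_mono power_mono) auto
  also have "\<dots> \<le> h / (c * \<xi>\<^sup>2) + C\<^sup>2 * (2 * \<xi> ^ 6 / m1)"
    using h_pos c_pos \<xi>(1) by simp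
  finally show ?thesis by (simp add: C_def)
qed

text \<open>As long as \<open>y \<ge> a / 2\<close>, the attraction by the third body is at most half of the binding
  term \<open>2 E x\<close>, so \<open>x'' \<le> - \<omega>\<^sup>2 x\<close>. Sturm comparison with \<open>sin (\<omega> s)\<close> then yields a zero of \<open>p\<close> by the
  time \<open>S = pi / (2 \<omega>)\<close>, before which \<open>y\<close> cannot fall to \<open>a / 2\<close> if \<open>a\<close> is large.\<close>

lemma y_pos_at_end_if_far:
  assumes p_pos: "\<And>s. \<lbrakk>0 \<le> s; s < T\<rbrakk> \<Longrightarrow> 0 < p s"
    and far1: "8 * k \<le> \<mu> * \<bar>E\<bar> * a" and \<omega>: "\<omega> = sqrt (\<bar>E\<bar> / (2 * m1))"
    and far2: "32 * c * k * (h / \<bar>E\<bar>)\<^sup>2 * (pi / (2 * \<omega>))\<^sup>2 < \<mu> * a ^ 3"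
  shows "0 < y T"
proof -
  define S where "S = pi / (2 * \<omega>)"
  have \<omega>_pos: "0 < \<omega>" using E m1 by (simp add: \<omega> divide_neg_pos)
  have S: "0 < S" using \<omega>_pos by (simp add: S_def)
  have high: "a / 2 \<le> y s" if s: "0 \<le> s" "s \<le> T" "s \<le> S" for s
  proof (rule ccontr)
    assume "\<not> a / 2 \<le> y s"
    then obtain t where t: "0 \<le> t" "t \<le> s" "\<mu> * a ^ 3 \<le> 32 * c * k * (x t) ^ 4 * t\<^sup>2"
      using descent_needs_width[OF s(1,2)] by (metis not_le)
    have "(x t) ^ 4 = ((x t)\<^sup>2)\<^sup>2" by (simp flip: power_mult)
    also have "\<dots> \<le> (h / \<bar>E\<bar>)\<^sup>2" using x_bound[of t] t s by (intro power_mono) auto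
    finally have "32 * c * k * (x t) ^ 4 * t\<^sup>2 \<le> 32 * c * k * (h / \<bar>E\<bar>)\<^sup>2 * S\<^sup>2"
      using t s c_pos k_pos by (intro mult_mono power_mono) auto
    then show False using t(3) far2 by (simp add: S_def)
  qed
  have "T \<le> S"
  proof (rule ccontr)
    assume "\<not> T \<le> S"
    then have ST: "S < T" by simp
    \<comment> \<open>The Wronskian of \<open>x\<close> and \<open>sin (\<omega> s)\<close>.\<close>
    define W where "W s = p s / (2 * m1) * sin (\<omega> * s) - \<omega> * x s * cos (\<omega> * s)" for s
    have "W S \<le> W 0"
    proof (rule DERIV_nonpos_imp_nonincreasing[of 0 S W])
      fix u assume u: "0 \<le> u" "u \<le> S"
      then have uT: "0 \<le> u" "u \<le> T" using ST by auto
      define f where "f = x u * (- 2 * c * (q u)\<^sup>2 + 4 * k * \<mu>\<^sup>2 * (y u)\<^sup>2 / r u ^ 3 + 2 * E)"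
      have yu: "a / 2 \<le> y u" using high u uT by simp
      have "4 * k * \<mu>\<^sup>2 * (y u)\<^sup>2 / r u ^ 3 \<le> \<bar>E\<bar>"
      proof -
        have yp: "0 < y u" using yu a by simp
        have "(\<mu> * y u) ^ 3 \<le> r u ^ 3"
          using sqrt_rad_ge(2) mu_pos yp by (intro power_mono) auto
        then have "4 * k * \<mu>\<^sup>2 * (y u)\<^sup>2 / r u ^ 3 \<le> 4 * k * \<mu>\<^sup>2 * (y u)\<^sup>2 / (\<mu> * y u) ^ 3"
          using mu_pos yp k_pos
          by (intro divide_left_mono) (auto intro!: mult_pos_pos zero_less_power r_pos uT)
        also have "\<dots> = 4 * k / (\<mu> * y u)"
          using mu_pos yp by (simp add: field_simps power2_eq_square power3_eq_cube)
        also have "\<dots> \<le> 4 * k / (\<mu> * (a / 2))"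
          using mu_pos yp a yu k_pos by (intro divide_left_mono mult_left_mono) auto
        also have "\<dots> \<le> \<bar>E\<bar>" using far1 mu_pos a by (simp add: field_simps)
        finally show ?thesis .
      qed
      moreover have "0 \<le> c * (q u)\<^sup>2" using c_pos by simp
      ultimately have "f \<le> x u * E"
        unfolding f_def using x_nonneg[OF uT] E by (intro mult_left_mono) auto
      then have "f / (2 * m1) + \<omega>\<^sup>2 * x u \<le> 0"
        using m1 E by (simp add: \<omega> field_simps)
      moreover have "0 \<le> sin (\<omega> * u)"
      proof (rule sin_ge_zero)
        show "0 \<le> \<omega> * u" using u \<omega>_pos by simp
        have "\<omega> * u \<le> \<omega> * S" using u \<omega>_pos by simp
        also have "\<dots> \<le> pi" using \<omega>_pos by (simp add: S_def)
        finally show "\<omega> * u \<le> pi" .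
      qed
      ultimately have neg: "(f / (2 * m1) + \<omega>\<^sup>2 * x u) * sin (\<omega> * u) \<le> 0"
        by (rule mult_nonpos_nonneg)
      have ds: "((\<lambda>s. sin (\<omega> * s)) has_real_derivative \<omega> * cos (\<omega> * u)) (at u)"
        and dc: "((\<lambda>s. \<omega> * x s * cos (\<omega> * s)) has_real_derivative
          \<omega> * (p u / (2 * m1)) * cos (\<omega> * u) - \<omega> * x u * (\<omega> * sin (\<omega> * u))) (at u)"
        by (auto intro!: derivative_eq_intros dx uT)
      have "(W has_real_derivative (f / (2 * m1) + \<omega>\<^sup>2 * x u) * sin (\<omega> * u)) (at u)"
        unfolding W_def
        by (rule DERIV_cong[OF DERIV_diff[OF DERIV_mult[OF DERIV_cdivide[OF dp[OF uT]] ds] dc], folded f_def])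
          (simp add: algebra_simps power2_eq_square)
      then show "\<exists>d. (W has_real_derivative d) (at u) \<and> d \<le> 0" using neg by blast
    qed (use S in simp)
    moreover have "\<omega> * S = pi / 2" using \<omega>_pos by (simp add: S_def)
    ultimately have "p S \<le> 0" using m1 by (simp add: W_def x0 divide_le_0_iff)
    then show False using p_pos[of S] S ST by simp
  qed
  then show ?thesis using high[of T] T a by simp
qed

text \<open>If \<open>p\<close> vanished at a positive time, \<open>x p \<ge> m1\<^sup>2 T\<close> would fail.\<close>

lemma p_pos_at_end_if_narrow:
  assumes "4 * \<bar>E\<bar> * (x T)\<^sup>2 \<le> m1\<^sup>2"
  shows "0 < p T"
proof (cases "T = 0")
  case False
  then have "0 < m1\<^sup>2 * T" using m1 T by simp
  also have "\<dots> \<le> x T * p T" using expansion[of T] assms T by simp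
  finally show ?thesis using x_nonneg[of T] p_nonneg[of T] T by (simp add: zero_less_mult_iff)
qed (use p0 m1 in simp)

text \<open>Heights scale like \<open>b\<^sup>2\<close> and times like \<open>b\<close> near the triple collision. By time \<open>b\<close> the momentum \<open>q\<close> has
  reached \<open>- D / b\<close>: either \<open>y\<close> stayed above \<open>a / 2\<close>, where the force can be bounded below, or it fell
  below, which takes such a momentum. From then on \<open>y' \<le> - c m1 D s\<^sup>2 / b\<close>, so that \<open>y\<close> loses the
  height \<open>b\<^sup>2\<close> before time \<open>n b\<close> for some \<open>n\<close> that does not depend on \<open>b\<close>. The hypothesis \<open>near\<close> keeps \<open>x\<close>
  small until then, so that the linear lower bound for \<open>x\<close> applies.\<close>

lemma duration_if_near:
  fixes b :: real
  defines "D \<equiv> min (k * \<mu>\<^sup>2 * m1 / (6 * sqrt ((h / m1)\<^sup>2 / 4 + \<mu>\<^sup>2) ^ 3)) (m1 / (4 * c * h))"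
  assumes b: "0 < b" "a = b\<^sup>2" and n: "n \<ge> 2" "n * (c * m1 * D) > 3 + c * m1 * D"
    and near: "4 * \<bar>E\<bar> * (sqrt (h / m1) * (n * b))\<^sup>2 \<le> m1\<^sup>2"
  shows "T < n * b"
proof (rule ccontr)
  define K where "K = sqrt (h / m1)"
  have K: "0 < K" "K\<^sup>2 = h / m1" using h_pos m1 by (simp_all add: K_def)
  have D: "0 < D"
    unfolding D_def using m1 h_pos mu_pos k_pos c_pos
    by (auto intro!: divide_pos_pos mult_pos_pos zero_less_power add_nonneg_pos)
  assume "\<not> T < n * b"
  then have nT: "n * b \<le> T" by simp
  have bn: "b \<le> n * b" using b n by simp
  have lower: "m1 / 2 * s\<^sup>2 \<le> (x s)\<^sup>2" and upper: "x s \<le> K * s" if s: "0 \<le> s" "s \<le> n * b" for s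
  proof -
    have sT: "0 \<le> s" "s \<le> T" using s nT by auto
    show u: "x s \<le> K * s" unfolding K_def by (rule x_le_linear[OF sT])
    also have "\<dots> \<le> K * (n * b)" using s K by (intro mult_left_mono) auto
    finally have "(x s)\<^sup>2 \<le> (K * (n * b))\<^sup>2" using x_nonneg[OF sT] by (intro power_mono) auto
    then have "4 * \<bar>E\<bar> * (x s)\<^sup>2 \<le> m1\<^sup>2"
      using near unfolding K_def
      by (meson abs_ge_zero mult_left_mono mult_nonneg_nonneg order_trans zero_le_numeral)
    then show "m1 / 2 * s\<^sup>2 \<le> (x s)\<^sup>2" by (rule x_ge_linear[OF sT])
  qed
  have bT: "0 \<le> b" "b \<le> T" using b bn nT by linarith+
  have qb: "q b \<le> - (D / b)"
  proof (cases "a / 2 \<le> y b")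
    case True
    \<comment> \<open>For times up to \<open>b\<close> the distance \<open>r\<close> is at most \<open>R b\<^sup>2\<close>, since \<open>x \<le> K b\<close> and \<open>y \<le> b\<^sup>2\<close>.\<close>
    define R where "R = sqrt (K ^ 4 / 4 + \<mu>\<^sup>2)"
    define d where "d = k * \<mu>\<^sup>2 * m1 / (6 * R ^ 3)"
    have R: "0 < R" using mu_pos by (simp add: R_def add_nonneg_pos)
    have K4: "K ^ 4 = (h / m1)\<^sup>2" unfolding K(2)[symmetric] by (simp flip: power_mult)
    have dD: "D \<le> d" by (simp add: D_def d_def R_def K4)
    have "q b + d / b ^ 4 * b ^ 3 \<le> q 0 + d / b ^ 4 * 0 ^ 3"
    proof (rule DERIV_nonpos_imp_nonincreasing[OF bT(1)])
      fix u assume u: "0 \<le> u" "u \<le> b"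
      then have uT: "0 \<le> u" "u \<le> T" "u \<le> n * b" using bT bn by auto
      have yu: "a / 2 \<le> y u" using y_antimono[of u b] True u bT by simp
      have "r u \<le> R * b\<^sup>2"
      proof (rule real_le_lsqrt)
        have "(x u) ^ 4 \<le> (K * b) ^ 4"
          using upper[OF uT(1,3)] u K x_nonneg[OF uT(1,2)]
          by (intro power_mono) (auto intro: order_trans mult_left_mono)
        moreover have "(y u)\<^sup>2 \<le> (b\<^sup>2)\<^sup>2"
          using y_le[OF uT(1,2)] y_nonneg[OF uT(1,2)] b by (intro power_mono) auto
        then have "\<mu>\<^sup>2 * (y u)\<^sup>2 \<le> \<mu>\<^sup>2 * (b\<^sup>2)\<^sup>2" by (intro mult_left_mono) auto
        ultimately have "rad (x u) (y u) \<le> (K * b) ^ 4 / 4 + \<mu>\<^sup>2 * (b\<^sup>2)\<^sup>2" by (simp add: rad_def)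
        also have "\<dots> = (K ^ 4 / 4 + \<mu>\<^sup>2) * b ^ 4"
          by (simp add: power_mult_distrib algebra_simps flip: power_mult)
        also have "\<dots> = (R * b\<^sup>2)\<^sup>2" by (simp add: R_def power_mult_distrib flip: power_mult)
        finally show "rad (x u) (y u) \<le> (R * b\<^sup>2)\<^sup>2" .
      qed (use R in \<open>auto simp: rad_nonneg\<close>)
      then have r3: "r u ^ 3 \<le> (R * b\<^sup>2) ^ 3" using rad_nonneg by (intro power_mono) auto
      have "3 * d * u\<^sup>2 / b ^ 4 = k * \<mu>\<^sup>2 * (m1 / 2 * u\<^sup>2) * b\<^sup>2 / (R * b\<^sup>2) ^ 3"
        using b R by (simp add: d_def field_simps power_mult_distrib flip: power_mult power_add)
      also have "\<dots> \<le> k * \<mu>\<^sup>2 * (m1 / 2 * u\<^sup>2) * b\<^sup>2 / r u ^ 3"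
        using r3 k_pos m1 R b r_pos[OF uT(1,2)]
        by (intro divide_left_mono) (auto intro!: mult_pos_pos zero_less_power)
      also have "\<dots> \<le> k * \<mu>\<^sup>2 * (x u)\<^sup>2 * (2 * y u) / r u ^ 3"
        using r_pos[OF uT(1,2)] lower[OF uT(1,3)] yu k_pos m1 b(2)
        by (intro divide_right_mono mult_mono) (auto intro: y_nonneg uT)
      finally have "- 2 * k * \<mu>\<^sup>2 * (x u)\<^sup>2 * y u / r u ^ 3 + 3 * d * u\<^sup>2 / b ^ 4 \<le> 0"
        by (simp add: mult_ac)
      moreover have "((\<lambda>s. q s + d / b ^ 4 * s ^ 3) has_real_derivative
          - 2 * k * \<mu>\<^sup>2 * (x u)\<^sup>2 * y u / r u ^ 3 + 3 * d * u\<^sup>2 / b ^ 4) (at u)"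
        by (rule derivative_eq_intros dq[OF uT(1,2)] refl)+ simp
      ultimately show "\<exists>e. ((\<lambda>s. q s + d / b ^ 4 * s ^ 3) has_real_derivative e) (at u) \<and> e \<le> 0" by blast
    qed
    moreover have "d / b ^ 4 * b ^ 3 = d / b" using b by (simp add: field_simps power_eq_if)
    ultimately have "q b \<le> - (d / b)" using q0 by simp
    also have "\<dots> \<le> - (D / b)" using dD b by (simp add: divide_right_mono)
    finally show ?thesis .
  next
    case False
    have "2 * c * (x b)\<^sup>2 * q b * b < - b\<^sup>2 / 2"
      using y_ge_of_q[OF bT] False b(2) by simp
    then have "b * b < b * (4 * c * (x b)\<^sup>2 * (- q b))"
      by (simp add: power2_eq_square[of b] mult_ac)
    then have "b < 4 * c * (x b)\<^sup>2 * (- q b)"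
      using b(1) mult_less_cancel_left_pos by blast
    also have "\<dots> \<le> 4 * c * (K\<^sup>2 * b\<^sup>2) * (- q b)"
    proof -
      have "(x b)\<^sup>2 \<le> (K * b)\<^sup>2"
        using upper[of b] bn x_nonneg[OF bT] bT by (intro power_mono) auto
      then show ?thesis
        using q_nonpos[OF bT] c_pos by (intro mult_right_mono mult_left_mono) (auto simp: power_mult_distrib)
    qed
    also have "\<dots> = b * (4 * c * h * b * (- q b) / m1)"
      by (simp add: K(2) power2_eq_square[of b] mult_ac)
    finally have "b * 1 < b * (4 * c * h * b * (- q b) / m1)" by simp
    then have "1 < 4 * c * h * b * (- q b) / m1"
      using b(1) mult_less_cancel_left_pos by blast
    then have "m1 / (4 * c * h) / b < - q b"
      using b(1) c_pos h_pos m1 by (simp add: field_simps)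
    moreover have "D / b \<le> m1 / (4 * c * h) / b" unfolding D_def using b(1) by (intro divide_right_mono) auto
    ultimately show ?thesis by simp
  qed
  define e where "e = c * m1 * D / (3 * b)"
  have "y (n * b) + e * (n * b) ^ 3 \<le> y b + e * b ^ 3"
  proof (rule DERIV_nonpos_imp_nonincreasing[OF bn])
    fix u assume u: "b \<le> u" "u \<le> n * b"
    then have uT: "0 \<le> u" "u \<le> T" using bT nT by auto
    have "D / b \<le> - q u" using qb q_antimono[of b u] u uT bT by simp
    then have "2 * c * ((m1 / 2 * u\<^sup>2) * (D / b)) \<le> 2 * c * ((x u)\<^sup>2 * (- q u))"
      using lower[OF uT(1) u(2)] c_pos m1 D b(1) by (intro mult_left_mono mult_mono) auto
    then have "2 * c * (x u)\<^sup>2 * q u + e * (3 * u\<^sup>2) \<le> 0"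
      using b(1) by (simp add: e_def mult_ac)
    moreover have "((\<lambda>s. y s + e * s ^ 3) has_real_derivative 2 * c * (x u)\<^sup>2 * q u + e * (3 * u\<^sup>2)) (at u)"
      by (rule derivative_eq_intros dy[OF uT] refl)+ simp
    ultimately show "\<exists>d. ((\<lambda>s. y s + e * s ^ 3) has_real_derivative d) (at u) \<and> d \<le> 0" by blast
  qed
  moreover have "0 \<le> y (n * b)" using y_nonneg nT b n by simp
  moreover have "y b \<le> b\<^sup>2" using y_le[OF bT] b(2) by simp
  ultimately have "e * (n * b) ^ 3 - e * b ^ 3 \<le> b\<^sup>2" by linarith
  moreover have "e * (n * b) ^ 3 - e * b ^ 3 = b\<^sup>2 * (c * m1 * D * (n ^ 3 - 1) / 3)"
    using b(1) by (simp add: e_def field_simps power_mult_distrib power2_eq_square power3_eq_cube)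
  ultimately have "b\<^sup>2 * (c * m1 * D * (n ^ 3 - 1) / 3) \<le> b\<^sup>2 * 1" by simp
  then have "c * m1 * D * (n ^ 3 - 1) / 3 \<le> 1"
    using b(1) by (subst (asm) mult_le_cancel_left_pos) auto
  then have "c * m1 * D * (n ^ 3 - 1) \<le> 3" by simp
  moreover have "n - 1 \<le> n ^ 3 - 1" using n(1) self_le_power[of n 3] by simp
  then have "c * m1 * D * (n - 1) \<le> c * m1 * D * (n ^ 3 - 1)"
    using c_pos m1 D by (intro mult_left_mono) auto
  ultimately show False using n(2) by (simp add: algebra_simps)
qed

end

context quadrant_arc begin

lemma q_neg:
  assumes s: "0 < s" "s \<le> T" and y_pos: "\<And>u. \<lbrakk>0 < u; u < s\<rbrakk> \<Longrightarrow> 0 < y u"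
  shows "q s < 0"
proof -
  have "q s < q 0"
  proof (rule DERIV_neg_imp_decreasing_open[of 0 s q])
    fix u assume u: "0 < u" "u < s"
    then have uT: "0 \<le> u" "u \<le> T" using s by auto
    have "0 < 2 * k * \<mu>\<^sup>2 * (x u)\<^sup>2 * y u / r u ^ 3"
      using k_pos mu_pos x_pos[of u] y_pos[OF u] u s r_pos[OF uT]
      by (intro divide_pos_pos mult_pos_pos zero_less_power) auto
    then show "\<exists>d. (q has_real_derivative d) (at u) \<and> d < 0"
      using dq[OF uT] by (intro exI[of _ "- 2 * k * \<mu>\<^sup>2 * (x u)\<^sup>2 * y u / r u ^ 3"]) simp
  next
    show "continuous_on {0..s} q"
      using s by (auto intro!: continuous_at_imp_continuous_on DERIV_isCont[OF dq])
  qed (use s in simp)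
  then show ?thesis by (simp add: q0)
qed

text \<open>Eliminating \<open>q\<close> by the energy relation at \<open>p = 0\<close> turns \<open>x p'\<close> into an expression that is at
  most \<open>- 2 m1\<^sup>2\<close>.\<close>

lemma dp_neg:
  assumes s: "0 < s" "s \<le> T" and ps: "p s = 0"
  shows "x s * (- 2 * c * (q s)\<^sup>2 + 4 * k * \<mu>\<^sup>2 * (y s)\<^sup>2 / r s ^ 3 + 2 * E) < 0"
proof -
  have sT: "0 \<le> s" "s \<le> T" using s by auto
  have r: "0 < r s" by (rule r_pos[OF sT])
  define D where "D = x s * (- 2 * c * (q s)\<^sup>2 + 4 * k * \<mu>\<^sup>2 * (y s)\<^sup>2 / r s ^ 3 + 2 * E)"
  have "\<mu>\<^sup>2 * (y s)\<^sup>2 \<le> (r s)\<^sup>2" by (simp add: rad_nonneg) (simp add: rad_def)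
  then have "4 * k * (x s)\<^sup>2 * (\<mu>\<^sup>2 * (y s)\<^sup>2) / r s ^ 3 \<le> 4 * k * (x s)\<^sup>2 * (r s)\<^sup>2 / r s ^ 3"
    using k_pos r by (intro divide_right_mono mult_left_mono) auto
  also have "\<dots> = 4 * k * (x s)\<^sup>2 / r s"
    using r by (simp only: power3_eq_cube power2_eq_square) (simp add: field_simps)
  finally have "4 * k * (x s)\<^sup>2 * (\<mu>\<^sup>2 * (y s)\<^sup>2) / r s ^ 3 \<le> 4 * k * (x s)\<^sup>2 / r s" .
  moreover have "x s * D = - 2 * (c * (q s)\<^sup>2 * (x s)\<^sup>2) + 4 * k * (x s)\<^sup>2 * (\<mu>\<^sup>2 * (y s)\<^sup>2) / r s ^ 3 + 2 * (E * (x s)\<^sup>2)"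
    by (simp add: D_def algebra_simps power2_eq_square)
  moreover have "c * (q s)\<^sup>2 * (x s)\<^sup>2 = 2 * k * (x s)\<^sup>2 / r s + m1\<^sup>2 + E * (x s)\<^sup>2"
    using energy[OF sT] ps by simp
  ultimately have "x s * D \<le> - 2 * m1\<^sup>2" by simp
  also have "\<dots> < 0" using m1 by simp
  finally show ?thesis using x_pos[OF s] by (simp add: D_def mult_less_0_iff)
qed

end

section \<open>The truncated vector field\<close>

context isosceles begin

text \<open>Each variable is clamped to \<open>[- M, M]\<close>, and the squared distance \<open>r\<^sup>2\<close> is cut off at \<open>\<delta>\<close> from below.\<close>

definition trunc :: "real \<Rightarrow> real \<Rightarrow> real \<times> real \<times> real \<times> real \<Rightarrow> real \<times> real \<times> real \<times> real" where
  "trunc \<delta> M z = (case z of (x, y, p, q) \<Rightarrow>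
     vf (inverse (sqrt (max \<delta> (rad (clamp_at M x) (clamp_at M y)))) ^ 3)
        (clamp_at M x) (clamp_at M y) (clamp_at M p) (clamp_at M q))"

definition core :: "real \<Rightarrow> real \<Rightarrow> (real \<times> real \<times> real \<times> real) set" where
  "core \<delta> M = {(x, y, p, q). \<delta> \<le> rad x y \<and> \<bar>x\<bar> \<le> M \<and> \<bar>y\<bar> \<le> M \<and> \<bar>p\<bar> \<le> M \<and> \<bar>q\<bar> \<le> M}"

lemma trunc_on_core:
  assumes "(x, y, p, q) \<in> core \<delta> M"
  shows "trunc \<delta> M (x, y, p, q) = vf (1 / sqrt (rad x y) ^ 3) x y p q"
  using assms by (simp add: trunc_def core_def clamp_at_id max_absorb2 field_simps)

lemma lipschitz_trunc:
  assumes "0 < \<delta>" "0 \<le> M"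
  obtains L where "L-lipschitz_on UNIV (trunc \<delta> M)"
proof -
  define X Y P Q :: "real \<times> real \<times> real \<times> real \<Rightarrow> real" where
    "X z = clamp_at M (fst z)" and "Y z = clamp_at M (fst (snd z))" and
    "P z = clamp_at M (fst (snd (snd z)))" and "Q z = clamp_at M (snd (snd (snd z)))" for z
  define w where "w z = inverse (sqrt (max \<delta> (rad (X z) (Y z))))" for z
  have XYPQ: "bounded_lipschitz X" "bounded_lipschitz Y" "bounded_lipschitz P" "bounded_lipschitz Q"
    unfolding X_def Y_def P_def Q_def
    by (rule bounded_lipschitz_clamp[OF assms(2)], rule lipschitz_fst_snd lipschitz_1_compose[OF lipschitz_fst_snd(2) lipschitz_fst_snd(1)]
        lipschitz_1_compose[OF lipschitz_fst_snd(2) lipschitz_1_compose[OF lipschitz_fst_snd(2) lipschitz_fst_snd(1)]]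
        lipschitz_1_compose[OF lipschitz_fst_snd(2) lipschitz_1_compose[OF lipschitz_fst_snd(2) lipschitz_fst_snd(2)]])+
  note bl = bounded_lipschitz_const bounded_lipschitz_add bounded_lipschitz_mult bounded_lipschitz_power XYPQ
  have "bounded_lipschitz (\<lambda>z. X z ^ 4 * (1 / 4) + \<mu>\<^sup>2 * (Y z)\<^sup>2)" by (intro bl)
  then have "bounded_lipschitz (\<lambda>z. rad (X z) (Y z))" by (simp add: rad_def)
  then have w: "bounded_lipschitz w" unfolding w_def
    by (rule bounded_lipschitz_compose[OF _ _ lipschitz_inverse_sqrt_max[OF assms(1)]]) simp
  have "bounded_lipschitz (\<lambda>z. P z * (1 / (2 * m1)))" by (intro bl)
  moreover have "bounded_lipschitz (\<lambda>z. 2 * c * (X z)\<^sup>2 * Q z)" by (intro bl)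
  moreover have "bounded_lipschitz (\<lambda>z. X z * (- 2 * c * (Q z)\<^sup>2 + 4 * k * \<mu>\<^sup>2 * (Y z)\<^sup>2 * w z ^ 3 + 2 * E))"
    by (intro bl w)
  moreover have "bounded_lipschitz (\<lambda>z. - 2 * k * \<mu>\<^sup>2 * (X z)\<^sup>2 * Y z * w z ^ 3)"
    by (intro bl w)
  ultimately obtain L where L: "L-lipschitz_on UNIV (\<lambda>z. (P z * (1 / (2 * m1)), 2 * c * (X z)\<^sup>2 * Q z,
      X z * (- 2 * c * (Q z)\<^sup>2 + 4 * k * \<mu>\<^sup>2 * (Y z)\<^sup>2 * w z ^ 3 + 2 * E),
      - 2 * k * \<mu>\<^sup>2 * (X z)\<^sup>2 * Y z * w z ^ 3))"
    by (rule bounded_lipschitz_quadruple)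
  have "L-lipschitz_on UNIV (trunc \<delta> M)"
    by (rule lipschitz_on_transform[OF L])
      (simp add: trunc_def vf_def X_def Y_def P_def Q_def w_def split: prod.split)
  then show thesis by (rule that)
qed

end

section \<open>The quarter orbit\<close>

context isosceles begin

text \<open>The strict inequalities describe an open set on whose closure the truncated and the true field
  agree. The bounds at time zero, which do not depend on an arc, start the continuation argument.\<close>

lemma uniform_bounds:
  assumes a1: "0 < a1" "a1 \<le> a2"
  obtains \<delta> M where "0 < \<delta>" "\<delta> < \<mu>\<^sup>2 * a1\<^sup>2" "a2 < M" "2 * m1 powr (3 / 2) < M"
    "\<And>a T x y p q s. \<lbrakk>quadrant_arc m1 m2 E a T x y p q; a1 \<le> a; a \<le> a2; 0 \<le> s; s \<le> T\<rbrakk> \<Longrightarrow>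
      \<delta> < rad (x s) (y s) \<and> \<bar>x s\<bar> < M \<and> \<bar>y s\<bar> < M \<and> \<bar>p s\<bar> < M \<and> \<bar>q s\<bar> < M"
proof -
  \<comment> \<open>Since \<open>\<xi> \<le> 1\<close>, the linear bounds in this minimum also control \<open>\<xi>\<^sup>2\<close> and \<open>\<xi> ^ 6\<close>.\<close>
  define \<xi> where "\<xi> = min 1 (min (m1\<^sup>2 / (4 * \<bar>E\<bar>)) (m1 * \<mu> * a1 ^ 3 / (128 * c * k)))"
  have \<xi>: "0 < \<xi>" "\<xi> \<le> 1" "\<xi> \<le> m1\<^sup>2 / (4 * \<bar>E\<bar>)" "\<xi> \<le> m1 * \<mu> * a1 ^ 3 / (128 * c * k)"
    unfolding \<xi>_def using m1 E mu_pos a1 c_pos k_pos by (auto intro!: divide_pos_pos mult_pos_pos divide_pos_neg)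
  have "\<xi>\<^sup>2 \<le> \<xi>" "\<xi> ^ 6 \<le> \<xi>" using \<xi>(1,2) power_decreasing[of 1 _ \<xi>] by auto
  have \<xi>2: "4 * \<bar>E\<bar> * \<xi>\<^sup>2 \<le> m1\<^sup>2"
    using order_trans[OF \<open>\<xi>\<^sup>2 \<le> \<xi>\<close> \<xi>(3)] E by (simp add: field_simps)
  have "128 * c * k * \<xi> ^ 6 \<le> m1 * \<mu> * a1 ^ 3"
    using order_trans[OF \<open>\<xi> ^ 6 \<le> \<xi>\<close> \<xi>(4)] c_pos k_pos by (simp add: field_simps)
  moreover have "0 < c * k * \<xi> ^ 6" using c_pos k_pos \<xi>(1) by simp
  ultimately have \<xi>6: "64 * c * k * \<xi> ^ 6 < m1 * \<mu> * a1 ^ 3" by linarith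
  define B where "B = h / (c * \<xi>\<^sup>2) + (8 * k / (\<mu> * a1\<^sup>2))\<^sup>2 * (2 * \<xi> ^ 6 / m1)"
  \<comment> \<open>Sums of bounds for squares suffice, because \<open>\<bar>u\<bar> < 1 + u\<^sup>2\<close>.\<close>
  define M where "M = 1 + a2 + h / \<bar>E\<bar> + 4 * m1 * h + 2 * m1 powr (3 / 2) + B"
  define \<delta> where "\<delta> = min (\<mu>\<^sup>2 * a1\<^sup>2 / 8) (\<xi> ^ 4 / 8)"
  have nn: "0 \<le> h / \<bar>E\<bar>" "0 \<le> 4 * m1 * h" "0 < 2 * m1 powr (3 / 2)" "0 \<le> B"
    using h_pos m1 c_pos by (auto simp: B_def)
  have below: "\<bar>u\<bar> < M" if "1 + u\<^sup>2 \<le> M" for u :: real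
  proof -
    have "0 \<le> (\<bar>u\<bar> - 1)\<^sup>2" by simp
    then have "2 * \<bar>u\<bar> \<le> 1 + u\<^sup>2" by (simp add: power2_diff)
    moreover have "0 < 1 + u\<^sup>2" by (simp add: add_pos_nonneg)
    ultimately show ?thesis using that by linarith
  qed
  have "0 < \<delta>" using mu_pos a1 \<xi>(1) by (simp add: \<delta>_def)
  moreover have "\<delta> < \<mu>\<^sup>2 * a1\<^sup>2"
  proof -
    have "0 < \<mu>\<^sup>2 * a1\<^sup>2" using mu_pos a1 by simp
    then show ?thesis unfolding \<delta>_def by linarith
  qed
  moreover have "a2 < M" "2 * m1 powr (3 / 2) < M" unfolding M_def using nn a1 by linarith+
  moreover have "\<delta> < rad (x s) (y s) \<and> \<bar>x s\<bar> < M \<and> \<bar>y s\<bar> < M \<and> \<bar>p s\<bar> < M \<and> \<bar>q s\<bar> < M"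
    if arc: "quadrant_arc m1 m2 E a T x y p q" and aa: "a1 \<le> a" "a \<le> a2" and s: "0 \<le> s" "s \<le> T"
    for a T x y p q s
  proof -
    interpret quadrant_arc m1 m2 E a T x y p q by (rule arc)
    have "a1 ^ 3 \<le> a ^ 3" using aa a1 by (intro power_mono) auto
    then have "m1 * \<mu> * a1 ^ 3 \<le> m1 * \<mu> * a ^ 3" using m1 mu_pos by (intro mult_left_mono) auto
    with \<xi>6 have \<xi>a: "64 * c * k * \<xi> ^ 6 < m1 * \<mu> * a ^ 3" by linarith
    have "2 * \<delta> \<le> rad (x s) (y s)"
    proof (cases "a / 2 \<le> y s")
      case True
      then have "(a1 / 2)\<^sup>2 \<le> (y s)\<^sup>2" using aa a1 by (intro power_mono) auto
      then have "\<mu>\<^sup>2 * (a1 / 2)\<^sup>2 \<le> \<mu>\<^sup>2 * (y s)\<^sup>2" by (intro mult_left_mono) auto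
      moreover have "2 * \<delta> \<le> \<mu>\<^sup>2 * (a1 / 2)\<^sup>2" by (simp add: \<delta>_def power_divide)
      moreover have "0 \<le> (x s) ^ 4 / 4" by simp
      ultimately show ?thesis unfolding rad_def by linarith
    next
      case False
      then have "\<xi> ^ 4 \<le> (x s) ^ 4" using rad_ge[OF s \<xi>(1) \<xi>2 \<xi>a] \<xi>(1) by (intro power_mono) auto
      moreover have "2 * \<delta> \<le> \<xi> ^ 4 / 4" "0 \<le> \<mu>\<^sup>2 * (y s)\<^sup>2" by (simp_all add: \<delta>_def)
      ultimately show ?thesis unfolding rad_def by linarith
    qed
    moreover have "\<bar>x s\<bar> < M"
      using x_bound[OF s] nn a1 by (intro below, unfold M_def) linarith
    moreover have "\<bar>p s\<bar> < M"
      using p_bound[OF s] nn a1 by (intro below, unfold M_def) linarith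
    moreover have "\<bar>y s\<bar> < M" using y_le[OF s] y_nonneg[OF s] aa \<open>a2 < M\<close> by simp
    moreover have "\<bar>q s\<bar> < M"
    proof (rule below)
      have "8 * k / (\<mu> * a\<^sup>2) \<le> 8 * k / (\<mu> * a1\<^sup>2)"
        using k_pos mu_pos a1 aa by (intro divide_left_mono mult_left_mono power_mono) auto
      then have "(8 * k / (\<mu> * a\<^sup>2))\<^sup>2 \<le> (8 * k / (\<mu> * a1\<^sup>2))\<^sup>2"
        using k_pos mu_pos by (intro power_mono) auto
      then have "(8 * k / (\<mu> * a\<^sup>2))\<^sup>2 * (2 * \<xi> ^ 6 / m1) \<le> (8 * k / (\<mu> * a1\<^sup>2))\<^sup>2 * (2 * \<xi> ^ 6 / m1)"
        using m1 \<xi>(1) by (intro mult_right_mono) auto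
      then have "(q s)\<^sup>2 \<le> B" using q_bound[OF s \<xi>(1) \<xi>2 \<xi>a] by (simp add: B_def)
      then show "1 + (q s)\<^sup>2 \<le> M" unfolding M_def using nn a1 by linarith
    qed
    ultimately show ?thesis using \<open>0 < \<delta>\<close> by linarith
  qed
  ultimately show thesis using that by blast
qed

text \<open>For \<open>a = b\<^sup>2\<close> small, the exit happens before time \<open>n b\<close>, when \<open>x\<close> is still in the range of the
  Lagrange-Jacobi argument.\<close>

lemma p_pos_at_end_if_a_small:
  obtains a0 where "0 < a0"
    "\<And>a T x y p q. \<lbrakk>quadrant_arc m1 m2 E a T x y p q; a \<le> a0\<rbrakk> \<Longrightarrow> 0 < p T"
proof -
  define D where "D = min (k * \<mu>\<^sup>2 * m1 / (6 * sqrt ((h / m1)\<^sup>2 / 4 + \<mu>\<^sup>2) ^ 3)) (m1 / (4 * c * h))"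
  define e where "e = c * m1 * D"
  have e: "0 < e"
    unfolding e_def D_def using m1 h_pos mu_pos k_pos c_pos
    by (auto intro!: divide_pos_pos mult_pos_pos zero_less_power add_nonneg_pos)
  \<comment> \<open>Any larger value would do: \<open>e (n - 1) > 3\<close> is what makes \<open>y (n b)\<close> negative.\<close>
  define n where "n = 2 + 3 / e"
  have n: "2 \<le> n" "3 + e < n * e" using e by (simp_all add: n_def distrib_right)
  define a0 where "a0 = m1\<^sup>2 / (4 * \<bar>E\<bar> * (h / m1) * n\<^sup>2)"
  have "0 < a0" unfolding a0_def using m1 E h_pos n by (intro divide_pos_pos mult_pos_pos) auto
  moreover have "0 < p T" if arc: "quadrant_arc m1 m2 E a T x y p q" and "a \<le> a0" for a T x y p q
  proof -
    interpret quadrant_arc m1 m2 E a T x y p q by (rule arc)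
    define b where "b = sqrt a"
    have b: "0 < b" "a = b\<^sup>2" using a by (simp_all add: b_def)
    have "4 * \<bar>E\<bar> * (sqrt (h / m1) * (n * b))\<^sup>2 = 4 * \<bar>E\<bar> * (h / m1) * n\<^sup>2 * a"
      using h_pos m1 by (simp add: power_mult_distrib b(2))
    also have "\<dots> \<le> 4 * \<bar>E\<bar> * (h / m1) * n\<^sup>2 * a0"
      using \<open>a \<le> a0\<close> h_pos m1 by (intro mult_left_mono) auto
    also have "\<dots> = m1\<^sup>2" unfolding a0_def using m1 E h_pos n by simp
    finally have near: "4 * \<bar>E\<bar> * (sqrt (h / m1) * (n * b))\<^sup>2 \<le> m1\<^sup>2" .
    have "T < n * b"
      by (rule duration_if_near[OF b n(1) _ near]) (use n(2) in \<open>simp add: e_def D_def\<close>)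
    then have "x T \<le> sqrt (h / m1) * (n * b)"
      using x_le_linear[of T] T h_pos m1 by (meson divide_pos_pos less_imp_le mult_left_mono order.trans order_refl real_sqrt_ge_zero)
    then have "(x T)\<^sup>2 \<le> (sqrt (h / m1) * (n * b))\<^sup>2"
      using x_nonneg[of T] T by (intro power_mono) auto
    then have "4 * \<bar>E\<bar> * (x T)\<^sup>2 \<le> m1\<^sup>2"
      using near by (meson abs_ge_zero mult_left_mono mult_nonneg_nonneg order_trans zero_le_numeral)
    then show ?thesis by (rule p_pos_at_end_if_narrow)
  qed
  ultimately show thesis using that by blast
qed

lemma y_pos_at_end_if_a_large:
  obtains a0 where
    "\<And>a T x y p q. \<lbrakk>quadrant_arc m1 m2 E a T x y p q; a0 \<le> a; \<forall>s\<in>{0..<T}. 0 < p s\<rbrakk>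
      \<Longrightarrow> 0 < y T"
proof -
  define \<omega> where "\<omega> = sqrt (\<bar>E\<bar> / (2 * m1))"
  define C where "C = 32 * c * k * (h / \<bar>E\<bar>)\<^sup>2 * (pi / (2 * \<omega>))\<^sup>2"
  have C: "0 \<le> C" using c_pos k_pos by (simp add: C_def)
  define a0 where "a0 = 1 + C / \<mu> + 8 * k / (\<mu> * \<bar>E\<bar>)"
  have "0 < y T" if arc: "quadrant_arc m1 m2 E a T x y p q" and aa: "a0 \<le> a"
    and pp: "\<forall>s\<in>{0..<T}. 0 < p s" for a T x y p q
  proof -
    interpret quadrant_arc m1 m2 E a T x y p q by (rule arc)
    have nn: "0 \<le> C / \<mu>" "0 \<le> 8 * k / (\<mu> * \<bar>E\<bar>)" using C mu_pos k_pos by auto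
    then have "8 * k / (\<mu> * \<bar>E\<bar>) \<le> a" "1 \<le> a" "C / \<mu> < a" using aa by (simp_all add: a0_def)
    moreover have "0 < \<mu> * \<bar>E\<bar>" using mu_pos E by (simp add: mult_pos_neg)
    ultimately have far1: "8 * k \<le> \<mu> * \<bar>E\<bar> * a" and "C < \<mu> * a"
      using mu_pos by (simp_all only: pos_divide_le_eq pos_divide_less_eq mult.commute)
    have "a \<le> a ^ 3" using \<open>1 \<le> a\<close> by (rule self_le_power) simp
    then have "\<mu> * a \<le> \<mu> * a ^ 3" using mu_pos by simp
    then have "C < \<mu> * a ^ 3" using \<open>C < \<mu> * a\<close> by linarith
    then show ?thesis
      unfolding C_def using y_pos_at_end_if_far[OF _ far1 \<omega>_def] pp by auto
  qed
  then show thesis using that by blast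
qed

lemma quadrant_is_left:
  assumes arc: "\<And>T. 0 \<le> T \<Longrightarrow> quadrant_arc m1 m2 E a T x y p q"
    and y_pos: "\<And>s. 0 \<le> s \<Longrightarrow> 0 < y s"
  shows False
proof -
  interpret A: quadrant_arc m1 m2 E a 1 x y p q by (rule arc) simp
  have x1: "0 < x 1" by (rule A.x_pos) auto
  have q1: "q 1 < 0" by (rule A.q_neg) (auto intro: y_pos)
  \<comment> \<open>From time 1 on, \<open>y\<close> descends at least with the speed it has then; by time \<open>t\<close> it has lost the height \<open>a\<close>.\<close>
  define b where "b = 2 * c * (x 1)\<^sup>2 * (- q 1)"
  have b: "0 < b" using x1 q1 c_pos by (simp add: b_def mult_pos_neg)
  define t where "t = 1 + a / b"
  have t: "1 \<le> t" using A.a b by (simp add: t_def)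
  interpret B: quadrant_arc m1 m2 E a t x y p q by (rule arc) (use t in simp)
  have "y t + b * t \<le> y 1 + b * 1"
  proof (rule DERIV_nonpos_imp_nonincreasing[OF t])
    fix u assume u: "1 \<le> u" "u \<le> t"
    then have uT: "0 \<le> u" "u \<le> t" by auto
    have "2 * c * ((x 1)\<^sup>2 * (- q 1)) \<le> 2 * c * ((x u)\<^sup>2 * (- q u))"
      using B.x_mono[of 1 u] B.q_antimono[of 1 u] u x1 q1 c_pos
      by (intro mult_left_mono mult_mono power_mono) auto
    then have "2 * c * (x u)\<^sup>2 * q u + b \<le> 0" by (simp add: b_def mult.assoc)
    moreover have "((\<lambda>s. y s + b * s) has_real_derivative 2 * c * (x u)\<^sup>2 * q u + b) (at u)"
      by (rule derivative_eq_intros B.dy[OF uT] refl)+ simp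
    ultimately show "\<exists>d. ((\<lambda>s. y s + b * s) has_real_derivative d) (at u) \<and> d \<le> 0" by blast
  qed
  moreover have "y 1 \<le> a" by (rule A.y_le) auto
  moreover have "b * t = b + a" using b by (simp add: t_def distrib_left)
  ultimately have "y t \<le> 0" by simp
  then show False using y_pos[of t] t by simp
qed

lemma solution_components:
  assumes Z: "(Z has_vector_derivative trunc \<delta> M (Z s)) (at s)" and core: "Z s \<in> core \<delta> M"
  defines "x \<equiv> \<lambda>s. fst (Z s)" and "y \<equiv> \<lambda>s. fst (snd (Z s))"
    and "p \<equiv> \<lambda>s. fst (snd (snd (Z s)))" and "q \<equiv> \<lambda>s. snd (snd (snd (Z s)))"
  shows "(x has_real_derivative p s / (2 * m1)) (at s)"
    and "(y has_real_derivative 2 * c * (x s)\<^sup>2 * q s) (at s)"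
    and "(p has_real_derivative x s * (- 2 * c * (q s)\<^sup>2
        + 4 * k * \<mu>\<^sup>2 * (y s)\<^sup>2 / sqrt (rad (x s) (y s)) ^ 3 + 2 * E)) (at s)"
    and "(q has_real_derivative - 2 * k * \<mu>\<^sup>2 * (x s)\<^sup>2 * y s / sqrt (rad (x s) (y s)) ^ 3) (at s)"
proof -
  have "trunc \<delta> M (Z s) = vf (1 / sqrt (rad (x s) (y s)) ^ 3) (x s) (y s) (p s) (q s)"
    using trunc_on_core[of "x s" "y s" "p s" "q s" \<delta> M] core by (simp add: x_def y_def p_def q_def)
  note Z' = Z[unfolded this vf_def]
  note d1 = bounded_linear.has_vector_derivative[OF bounded_linear_fst]
  note d2 = bounded_linear.has_vector_derivative[OF bounded_linear_snd]
  show "(x has_real_derivative p s / (2 * m1)) (at s)"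
    using d1[OF Z'] by (simp add: x_def has_real_derivative_iff_has_vector_derivative)
  show "(y has_real_derivative 2 * c * (x s)\<^sup>2 * q s) (at s)"
    using d1[OF d2[OF Z']] by (simp add: y_def has_real_derivative_iff_has_vector_derivative)
  show "(p has_real_derivative x s * (- 2 * c * (q s)\<^sup>2
        + 4 * k * \<mu>\<^sup>2 * (y s)\<^sup>2 / sqrt (rad (x s) (y s)) ^ 3 + 2 * E)) (at s)"
    using d1[OF d2[OF d2[OF Z']]] by (simp add: p_def has_real_derivative_iff_has_vector_derivative)
  show "(q has_real_derivative - 2 * k * \<mu>\<^sup>2 * (x s)\<^sup>2 * y s / sqrt (rad (x s) (y s)) ^ 3) (at s)"
    using d2[OF d2[OF d2[OF Z']]] by (simp add: q_def has_real_derivative_iff_has_vector_derivative)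
qed

text \<open>Shooting for the flow of the truncated field. An arc in the quadrant of this flow solves the true
  equations as long as it is in the core; the uniform bounds then keep it in the interior of the
  core, so it never leaves.\<close>

lemma quarter_orbit:
  obtains \<delta> M a T Z where "0 < \<delta>" "0 \<le> M" "0 < T"
    "Z 0 = (0, a, 2 * m1 powr (3 / 2), 0)"
    "\<And>t. (Z has_vector_derivative trunc \<delta> M (Z t)) (at t)"
    "\<And>s. \<lbrakk>0 \<le> s; s \<le> T\<rbrakk> \<Longrightarrow> Z s \<in> core \<delta> M"
    "quadrant_arc m1 m2 E a T (\<lambda>s. fst (Z s)) (\<lambda>s. fst (snd (Z s)))
      (\<lambda>s. fst (snd (snd (Z s)))) (\<lambda>s. snd (snd (snd (Z s))))"
    "\<And>s. \<lbrakk>0 \<le> s; s < T\<rbrakk> \<Longrightarrow> 0 < fst (snd (Z s)) \<and> 0 < fst (snd (snd (Z s)))"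
    "fst (snd (Z T)) = 0" "fst (snd (snd (Z T))) = 0"
proof -
  obtain a1 where a1: "0 < a1" and small:
    "\<And>a T x y p q. \<lbrakk>quadrant_arc m1 m2 E a T x y p q; a \<le> a1\<rbrakk> \<Longrightarrow> 0 < p T"
    by (rule p_pos_at_end_if_a_small, rule that)
  obtain a0 where large:
    "\<And>a T x y p q. \<lbrakk>quadrant_arc m1 m2 E a T x y p q; a0 \<le> a; \<forall>s\<in>{0..<T}. 0 < p s\<rbrakk>
      \<Longrightarrow> 0 < y T"
    by (rule y_pos_at_end_if_a_large, rule that)
  define a2 where "a2 = max a0 a1"
  have a12: "a1 \<le> a2" "a0 \<le> a2" by (simp_all add: a2_def)
  obtain \<delta> M where \<delta>: "0 < \<delta>" "\<delta> < \<mu>\<^sup>2 * a1\<^sup>2" and M: "a2 < M" "2 * m1 powr (3 / 2) < M" and bounds: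
    "\<And>a T x y p q s. \<lbrakk>quadrant_arc m1 m2 E a T x y p q; a1 \<le> a; a \<le> a2; 0 \<le> s; s \<le> T\<rbrakk> \<Longrightarrow>
      \<delta> < rad (x s) (y s) \<and> \<bar>x s\<bar> < M \<and> \<bar>y s\<bar> < M \<and> \<bar>p s\<bar> < M \<and> \<bar>q s\<bar> < M"
    using uniform_bounds[OF a1 a12(1)] by metis
  have M0: "0 < M" using M a1 a12 by linarith
  obtain L where L: "L-lipschitz_on UNIV (trunc \<delta> M)"
    using lipschitz_trunc[OF \<delta>(1), of M] M0 by auto
  have L0: "0 \<le> L" using L by (rule lipschitz_on_nonneg)
  have "\<exists>z. z 0 = (0, a, 2 * m1 powr (3 / 2), 0) \<and> (\<forall>t. (z has_vector_derivative trunc \<delta> M (z t)) (at t))" for a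
    using lipschitz_ode_solution_exists[OF L, of "(0, a, 2 * m1 powr (3 / 2), 0)"] by metis
  then obtain Z where Z0: "\<And>a. Z a 0 = (0, a, 2 * m1 powr (3 / 2), 0)"
    and Z: "\<And>a t. (Z a has_vector_derivative trunc \<delta> M (Z a t)) (at t)" by metis
  define X Y P Q where "X a s = fst (Z a s)" and "Y a s = fst (snd (Z a s))"
    and "P a s = fst (snd (snd (Z a s)))" and "Q a s = snd (snd (snd (Z a s)))" for a s
  note comps = X_def Y_def P_def Q_def
  have contZ: "continuous_on S (Z a)" for a S
    by (meson Z continuous_at_imp_continuous_on has_vector_derivative_continuous)
  have contY: "continuous_on S (Y a)" and contP: "continuous_on S (P a)" for a S
    unfolding Y_def P_def by (intro continuous_intros contZ)+
  have p0: "0 < 2 * m1 powr (3 / 2)" using m1 by simp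
  define U where "U = {z. \<delta> < rad (fst z) (fst (snd z)) \<and> \<bar>fst z\<bar> < M \<and> \<bar>fst (snd z)\<bar> < M
    \<and> \<bar>fst (snd (snd z))\<bar> < M \<and> \<bar>snd (snd (snd z))\<bar> < M}"
  have "open U" unfolding U_def rad_def
    by (intro open_Collect_conj open_Collect_less continuous_intros) auto
  have core_alt: "core \<delta> M = {z. \<delta> \<le> rad (fst z) (fst (snd z)) \<and> \<bar>fst z\<bar> \<le> M \<and> \<bar>fst (snd z)\<bar> \<le> M
    \<and> \<bar>fst (snd (snd z))\<bar> \<le> M \<and> \<bar>snd (snd (snd z))\<bar> \<le> M}"
    by (auto simp: core_def)
  have "closed (core \<delta> M)" unfolding core_alt rad_def
    by (intro closed_Collect_conj closed_Collect_le continuous_intros) auto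
  have "U \<subseteq> core \<delta> M" by (auto simp: U_def core_alt)
  have arc: "quadrant_arc m1 m2 E a T (X a) (Y a) (P a) (Q a)"
    if "a1 \<le> a" "0 \<le> T" and core: "\<And>s. \<lbrakk>0 \<le> s; s \<le> T\<rbrakk> \<Longrightarrow> Z a s \<in> core \<delta> M"
      and quad: "\<And>s. \<lbrakk>0 \<le> s; s \<le> T\<rbrakk> \<Longrightarrow> 0 \<le> Y a s \<and> 0 \<le> P a s" for a T
  proof unfold_locales
    fix s assume s: "0 \<le> s" "s \<le> T"
    show "0 < rad (X a s) (Y a s)" using core[OF s] \<delta>(1) by (simp add: core_alt comps)
    show "0 \<le> Y a s" "0 \<le> P a s" using quad[OF s] by auto
    note d = solution_components[OF Z core[OF s]]
    show "(X a has_real_derivative P a s / (2 * m1)) (at s)" using d(1) by (simp add: comps[abs_def])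
    show "(Y a has_real_derivative 2 * c * (X a s)\<^sup>2 * Q a s) (at s)" using d(2) by (simp add: comps[abs_def])
    show "(P a has_real_derivative X a s * (- 2 * c * (Q a s)\<^sup>2
        + 4 * k * \<mu>\<^sup>2 * (Y a s)\<^sup>2 / sqrt (rad (X a s) (Y a s)) ^ 3 + 2 * E)) (at s)"
      using d(3) by (simp add: comps[abs_def])
    show "(Q a has_real_derivative - 2 * k * \<mu>\<^sup>2 * (X a s)\<^sup>2 * Y a s / sqrt (rad (X a s) (Y a s)) ^ 3) (at s)"
      using d(4) by (simp add: comps[abs_def])
  qed (use that a1 Z0 in \<open>auto simp: comps\<close>)
  have in_U: "Z a s \<in> U"
    if a: "a1 \<le> a" "a \<le> a2" and quad: "\<And>s. \<lbrakk>0 \<le> s; s \<le> T\<rbrakk> \<Longrightarrow> 0 \<le> Y a s \<and> 0 \<le> P a s"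
      and s: "0 \<le> s" "s \<le> T" for a s T
  proof (rule stays_in_open[OF contZ \<open>open U\<close> \<open>closed (core \<delta> M)\<close> \<open>U \<subseteq> core \<delta> M\<close> _ _ s])
    have "\<mu>\<^sup>2 * a1\<^sup>2 \<le> \<mu>\<^sup>2 * a\<^sup>2" using a a1 by (intro mult_left_mono power_mono) auto
    then show "Z a 0 \<in> core \<delta> M"
      unfolding core_alt using \<delta> M a a1 p0 by (simp add: Z0 rad_def)
    fix t assume t: "0 \<le> t" "t \<le> T" "\<And>s. \<lbrakk>0 \<le> s; s \<le> t\<rbrakk> \<Longrightarrow> Z a s \<in> core \<delta> M"
    have "quadrant_arc m1 m2 E a t (X a) (Y a) (P a) (Q a)"
      using t quad by (intro arc a(1)) auto
    from bounds[OF this a t(1) order_refl] show "Z a t \<in> U" by (simp add: U_def comps)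
  qed
  have arc': "quadrant_arc m1 m2 E a T (X a) (Y a) (P a) (Q a)"
    if "a1 \<le> a" "a \<le> a2" "0 \<le> T" "\<And>s. \<lbrakk>0 \<le> s; s \<le> T\<rbrakk> \<Longrightarrow> 0 \<le> Y a s \<and> 0 \<le> P a s" for a T
    using that in_U[OF that(1,2,4)] \<open>U \<subseteq> core \<delta> M\<close> by (intro arc) auto
  have "\<exists>T. 0 < T \<and> min (Y a T) (P a T) = 0 \<and> (\<forall>s\<in>{0..<T}. 0 < Y a s \<and> 0 < P a s)"
    if a: "a1 \<le> a" "a \<le> a2" for a
  proof -
    have leaves: "\<exists>t\<ge>0. min (Y a t) (P a t) \<le> 0"
    proof (rule ccontr)
      assume "\<not> ?thesis"
      then have pos: "0 < Y a t \<and> 0 < P a t" if "0 \<le> t" for t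
        using that by (simp add: min_le_iff_disj not_le) (meson not_le)
      show False by (rule quadrant_is_left[OF arc'[OF a]]) (use pos in \<open>auto intro: less_imp_le\<close>)
    qed
    have cont: "continuous_on UNIV (\<lambda>t. min (Y a t) (P a t))" by (intro continuous_intros contY contP)
    have start: "0 < min (Y a 0) (P a 0)" using a a1 p0 by (simp add: comps Z0)
    obtain T where "0 < T" "min (Y a T) (P a T) = 0"
      "\<And>s. \<lbrakk>0 \<le> s; s < T\<rbrakk> \<Longrightarrow> 0 < min (Y a s) (P a s)"
      by (rule first_zero[OF cont start leaves]) (rule that)
    then show ?thesis by (intro exI[of _ T]) auto
  qed
  then obtain T where T: "\<And>a. \<lbrakk>a1 \<le> a; a \<le> a2\<rbrakk> \<Longrightarrow> 0 < T a \<and> min (Y a (T a)) (P a (T a)) = 0 \<and>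
      (\<forall>s\<in>{0..<T a}. 0 < Y a s \<and> 0 < P a s)" by metis
  have quad: "0 \<le> Y a s \<and> 0 \<le> P a s" if a: "a1 \<le> a" "a \<le> a2" and s: "0 \<le> s" "s \<le> T a" for a s
  proof (cases "s = T a")
    case True
    then show ?thesis using T[OF a] by (auto simp: min_def split: if_splits)
  next
    case False
    then have "0 < Y a s \<and> 0 < P a s" using T[OF a] s by simp
    then show ?thesis by simp
  qed
  have exit_arc: "quadrant_arc m1 m2 E a (T a) (X a) (Y a) (P a) (Q a)" if a: "a1 \<le> a" "a \<le> a2" for a
    using T[OF a] quad[OF a] by (intro arc' a) auto
  obtain a where a: "a1 \<le> a" "a \<le> a2" and hit: "Y a (T a) = 0" "P a (T a) = 0"
  proof (rule shooting[of Y P a1 a2 T])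
    fix a s e :: real assume s: "0 \<le> s" and e: "0 < e"
    show "\<exists>d>0. \<forall>a'. \<bar>a' - a\<bar> < d \<longrightarrow> (\<forall>t\<in>{0..s}. \<bar>Y a' t - Y a t\<bar> < e \<and> \<bar>P a' t - P a t\<bar> < e)"
    proof (intro exI[of _ "e / exp (L * s)"] conjI allI impI ballI)
      fix a' t assume a': "\<bar>a' - a\<bar> < e / exp (L * s)" and t: "t \<in> {0..s}"
      have "dist (Z a' t) (Z a t) \<le> exp (L * t) * dist (Z a' 0) (Z a 0)"
        using t by (intro lipschitz_ode_forward_dependence[OF L Z Z]) auto
      also have "\<dots> \<le> exp (L * s) * dist (Z a' 0) (Z a 0)"
        using t L0 by (intro mult_right_mono) (auto intro: mult_left_mono)
      also have "dist (Z a' 0) (Z a 0) = \<bar>a' - a\<bar>" by (simp add: Z0 dist_Pair_Pair dist_real_def)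
      also have "exp (L * s) * \<bar>a' - a\<bar> < e" using a' by (simp add: field_simps)
      finally have d: "dist (Z a' t) (Z a t) < e" .
      have "dist (Y a' t) (Y a t) \<le> dist (Z a' t) (Z a t)" "dist (P a' t) (P a t) \<le> dist (Z a' t) (Z a t)"
        unfolding Y_def P_def by (meson dist_fst_le dist_snd_le order_trans)+
      then show "\<bar>Y a' t - Y a t\<bar> < e" "\<bar>P a' t - P a t\<bar> < e" using d by (auto simp: dist_real_def)
    qed (use e in simp)
  next
    fix a assume a: "a1 \<le> a" "a \<le> a2"
    interpret A: quadrant_arc m1 m2 E a "T a" "X a" "Y a" "P a" "Q a" by (rule exit_arc[OF a])
    have Tp: "0 < T a" "0 \<le> T a" using T[OF a] by auto
    show "\<exists>D<0. (Y a has_real_derivative D) (at (T a))"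
    proof (intro exI conjI)
      have "Q a (T a) < 0" using T[OF a] by (intro A.q_neg) auto
      then show "2 * c * (X a (T a))\<^sup>2 * Q a (T a) < 0"
        using A.x_pos[OF Tp(1)] c_pos by (intro mult_pos_neg) auto
    qed (use A.dy[OF Tp(2)] in simp)
    show "\<exists>D<0. (P a has_real_derivative D) (at (T a))" if "P a (T a) = 0"
      using A.dp[OF Tp(2) order_refl] A.dp_neg[OF Tp(1) order_refl that] by blast
  qed (use T contY contP a12 small[OF exit_arc[OF order_refl a12(1)]] in
        \<open>auto intro!: large[OF exit_arc[OF a12(1) order_refl] a12(2)]\<close>)
  show thesis
  proof (rule that[OF \<delta>(1), where Z = "Z a" and T = "T a"])
    show "\<And>s. \<lbrakk>0 \<le> s; s \<le> T a\<rbrakk> \<Longrightarrow> Z a s \<in> core \<delta> M"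
      using in_U[OF a quad[OF a]] \<open>U \<subseteq> core \<delta> M\<close> by blast
  qed (use M0 T[OF a] Z0 Z exit_arc[OF a] hit in \<open>auto simp: comps[abs_def]\<close>)
qed

end

section \<open>Extension by reversing symmetries\<close>

text \<open>If the linear map \<open>A\<close> reverses the field, it maps solutions to solutions run backwards.\<close>

lemma reversed_solution:
  fixes F :: "'a::real_normed_vector \<Rightarrow> 'a"
  assumes Z: "\<And>t. (Z has_vector_derivative F (Z t)) (at t)"
    and A: "bounded_linear A" and anti: "\<And>z. F (A z) = - A (F z)"
  shows "((\<lambda>s. A (Z (r - s))) has_vector_derivative F (A (Z (r - s)))) (at s)"
proof -
  have "((\<lambda>s. r - s) has_vector_derivative - 1) (at s)"
    unfolding has_real_derivative_iff_has_vector_derivative[symmetric]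
    by (auto intro!: derivative_eq_intros)
  from bounded_linear.has_vector_derivative[OF A vector_diff_chain_at[OF this Z]]
  show ?thesis by (simp add: o_def anti linear_neg[OF bounded_linear.linear[OF A]])
qed

lemma periodic_int:
  fixes f :: "real \<Rightarrow> 'a"
  assumes per: "\<And>s. f (s + w) = f s"
  shows "f (s + of_int n * w) = f s"
proof -
  have nat: "f (s + real n * w) = f s" for n s
  proof (induction n)
    case (Suc n)
    then show ?case using per[of "s + real n * w"] by (simp add: algebra_simps)
  qed simp
  show ?thesis
  proof (cases n)
    case (nonneg m) then show ?thesis using nat by simp
  next
    case (neg m)
    then have "(of_int n + real (Suc m)) * w = 0" by simp
    then have "of_int n * w + real (Suc m) * w = 0" by (simp only: distrib_right)
    then show ?thesis using nat[of "s + of_int n * w" "Suc m"] by (simp only: add.assoc add_0_right)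
  qed
qed

definition reflect_x :: "real \<times> real \<times> real \<times> real \<Rightarrow> real \<times> real \<times> real \<times> real" where
  "reflect_x z = (- fst z, fst (snd z), fst (snd (snd z)), - snd (snd (snd z)))"

definition reflect_y :: "real \<times> real \<times> real \<times> real \<Rightarrow> real \<times> real \<times> real \<times> real" where
  "reflect_y z = (fst z, - fst (snd z), - fst (snd (snd z)), snd (snd (snd z)))"

lemma bounded_linear_reflect: "bounded_linear reflect_x" "bounded_linear reflect_y"
  unfolding reflect_x_def[abs_def] reflect_y_def[abs_def]
  by (intro bounded_linear_Pair bounded_linear_minus bounded_linear_fst_comp bounded_linear_snd_comp
      bounded_linear_fst bounded_linear_snd bounded_linear_ident
      bounded_linear_compose[OF bounded_linear_fst] bounded_linear_compose[OF bounded_linear_snd])+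

text \<open>By uniqueness each reversing symmetry that fixes a point of the solution fixes the whole solution. The
  composition of the two time reversals is a shift by \<open>2 T\<close> combined with \<open>z \<mapsto> - z\<close>, whose square
  is the shift by \<open>4 T\<close>.\<close>

lemma symmetric_extension:
  fixes F :: "real \<times> real \<times> real \<times> real \<Rightarrow> real \<times> real \<times> real \<times> real"
  assumes L: "L-lipschitz_on UNIV F"
    and Z: "\<And>t. (Z has_vector_derivative F (Z t)) (at t)"
    and anti: "\<And>z. F (reflect_x z) = - reflect_x (F z)" "\<And>z. F (reflect_y z) = - reflect_y (F z)"
    and Z0: "reflect_x (Z 0) = Z 0" and ZT: "reflect_y (Z T) = Z T"
  shows "Z (- s) = reflect_x (Z s)" and "Z (2 * T - s) = reflect_y (Z s)" and "Z (s + 4 * T) = Z s"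
proof -
  show x: "Z (- s) = reflect_x (Z s)" for s
    using lipschitz_ode_unique[OF L Z reversed_solution[OF Z bounded_linear_reflect(1) anti(1)], of 0 0 "- s"] Z0
    by simp
  show y: "Z (2 * T - s) = reflect_y (Z s)" for s
    using lipschitz_ode_unique[OF L Z reversed_solution[OF Z bounded_linear_reflect(2) anti(2)], of T "2 * T" "2 * T - s"] ZT
    by simp
  have "Z (s + 4 * T) = Z (2 * T - - (2 * T - - s))" by (simp add: add.commute)
  also have "\<dots> = reflect_y (reflect_x (reflect_y (reflect_x (Z s))))" by (simp only: x y)
  also have "\<dots> = Z s" by (simp add: reflect_x_def reflect_y_def)
  finally show "Z (s + 4 * T) = Z s" .
qed

context isosceles begin

lemma trunc_reflect:
  assumes "0 \<le> M"
  shows "trunc \<delta> M (reflect_x z) = - reflect_x (trunc \<delta> M z)"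
    and "trunc \<delta> M (reflect_y z) = - reflect_y (trunc \<delta> M z)"
  using assms by (auto simp: trunc_def reflect_x_def reflect_y_def vf_def clamp_at_minus rad_def split: prod.split)

text \<open>The part of the core on which \<open>\<Gamma> = 0\<close>. Both conditions are symmetric, so it is enough to know them on
  the quarter orbit.\<close>

definition zero_energy_core :: "real \<Rightarrow> real \<Rightarrow> (real \<times> real \<times> real \<times> real) set" where
  "zero_energy_core \<delta> M = {(x, y, p, q). (x, y, p, q) \<in> core \<delta> M \<and>
     p\<^sup>2 / (4 * m1) + c * q\<^sup>2 * x\<^sup>2 = 2 * k * x\<^sup>2 / sqrt (rad x y) + m1\<^sup>2 + E * x\<^sup>2}"

lemma reflect_zero_energy_core:
  "z \<in> zero_energy_core \<delta> M \<Longrightarrow> reflect_x z \<in> zero_energy_core \<delta> M"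
  "z \<in> zero_energy_core \<delta> M \<Longrightarrow> reflect_y z \<in> zero_energy_core \<delta> M"
  by (auto simp: zero_energy_core_def core_def reflect_x_def reflect_y_def rad_def)

text \<open>The reflections carry the property from \<open>[0, T]\<close> to \<open>[- T, T]\<close> and then to \<open>[- T, 3 T]\<close>, a full
  period.\<close>

lemma stays_in_zero_energy_core:
  fixes Z :: "real \<Rightarrow> real \<times> real \<times> real \<times> real" and T s :: real
  assumes T: "0 < T" and quarter: "\<And>s. \<lbrakk>0 \<le> s; s \<le> T\<rbrakk> \<Longrightarrow> Z s \<in> zero_energy_core \<delta> M"
    and x: "\<And>s. Z (- s) = reflect_x (Z s)" and y: "\<And>s. Z (2 * T - s) = reflect_y (Z s)"
    and per: "\<And>s. Z (s + 4 * T) = Z s"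
  shows "Z s \<in> zero_energy_core \<delta> M"
proof -
  have half: "Z s \<in> zero_energy_core \<delta> M" if "- T \<le> s" "s \<le> T" for s
  proof (cases "0 \<le> s")
    case False
    then have "reflect_x (Z (- s)) \<in> zero_energy_core \<delta> M"
      using that by (intro reflect_zero_energy_core(1) quarter) auto
    then show ?thesis by (simp flip: x)
  qed (use quarter that in simp)
  have period: "Z s \<in> zero_energy_core \<delta> M" if "- T \<le> s" "s \<le> 3 * T" for s
  proof (cases "s \<le> T")
    case False
    then have "reflect_y (Z (2 * T - s)) \<in> zero_energy_core \<delta> M"
      using that by (intro reflect_zero_energy_core(2) half) auto
    then show ?thesis by (simp flip: y)
  qed (use half that in simp)
  \<comment> \<open>The number of periods that separate \<open>s\<close> from \<open>[- T, 3 T]\<close>.\<close>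
  define n where "n = \<lfloor>(s + T) / (4 * T)\<rfloor>"
  have "of_int n \<le> (s + T) / (4 * T)" "(s + T) / (4 * T) \<le> of_int n + 1" by (simp_all add: n_def)
  then have "- T \<le> s - of_int n * (4 * T)" "s - of_int n * (4 * T) \<le> 3 * T"
    using T by (simp_all add: field_simps)
  from period[OF this] show ?thesis
    using periodic_int[of Z "4 * T" "s - of_int n * (4 * T)" n] per by simp
qed

end

section \<open>Return to four degrees of freedom\<close>

context isosceles begin

definition slice_embedding :: "real \<times> real \<times> real \<times> real \<Rightarrow> phase" where
  "slice_embedding z = (vector [fst z, 0, 0, fst (snd z)], vector [fst (snd (snd z)), 0, 0, snd (snd (snd z))])"

lemma vector_4_nth [simp]:
  "(vector [u, v, w, z] :: real^4) $ 1 = u" "(vector [u, v, w, z] :: real^4) $ 2 = v"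
  "(vector [u, v, w, z] :: real^4) $ 3 = w" "(vector [u, v, w, z] :: real^4) $ 4 = z"
  unfolding vector_def by simp_all

lemma radicand_slice:
  "radicand_plus m1 m2 (vector [x, 0, 0, y]) = rad x y" "radicand_minus m1 m2 (vector [x, 0, 0, y]) = rad x y"
  by (simp_all add: radicand_plus_def radicand_minus_def Qbold_def rad_def \<mu>_def flip: power_mult)

lemma Gamma_slice:
  "Gamma m1 m2 E (vector [x, 0, 0, y]) (vector [p, 0, 0, q])
    = p\<^sup>2 / (4 * m1) + c * q\<^sup>2 * x\<^sup>2 - 2 * k * x\<^sup>2 / sqrt (rad x y) - m1\<^sup>2 - E * x\<^sup>2"
  by (simp add: Gamma_def radicand_slice c_def k_def mult_ac)

lemma partial_P:
  "partial_deriv (\<lambda>P. Gamma m1 m2 E (vector [x, 0, 0, y]) P) 1 (vector [p, 0, 0, q]) = p / (2 * m1)"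
  "partial_deriv (\<lambda>P. Gamma m1 m2 E (vector [x, 0, 0, y]) P) 2 (vector [p, 0, 0, q]) = 0"
  "partial_deriv (\<lambda>P. Gamma m1 m2 E (vector [x, 0, 0, y]) P) 3 (vector [p, 0, 0, q]) = 0"
  "partial_deriv (\<lambda>P. Gamma m1 m2 E (vector [x, 0, 0, y]) P) 4 (vector [p, 0, 0, q]) = 2 * c * x\<^sup>2 * q"
  unfolding partial_deriv_def Gamma_def radicand_slice
  by (rule DERIV_imp_deriv; use m1 in \<open>auto intro!: derivative_eq_intros simp: axis_def c_def\<close>)+

text \<open>The derivatives in the directions \<open>Q\<^sub>2\<close> and \<open>Q\<^sub>3\<close> vanish because those of the two radicands are
  opposite and the radicands agree on the slice; this is why the slice is invariant.\<close>

lemma partial_Q: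
  assumes "rad x y > 0"
  shows "partial_deriv (\<lambda>Q. Gamma m1 m2 E Q (vector [p, 0, 0, q])) 1 (vector [x, 0, 0, y])
      = - (x * (- 2 * c * q\<^sup>2 + 4 * k * \<mu>\<^sup>2 * y\<^sup>2 / sqrt (rad x y) ^ 3 + 2 * E))"
  and "partial_deriv (\<lambda>Q. Gamma m1 m2 E Q (vector [p, 0, 0, q])) 2 (vector [x, 0, 0, y]) = 0"
  and "partial_deriv (\<lambda>Q. Gamma m1 m2 E Q (vector [p, 0, 0, q])) 3 (vector [x, 0, 0, y]) = 0"
  and "partial_deriv (\<lambda>Q. Gamma m1 m2 E Q (vector [p, 0, 0, q])) 4 (vector [x, 0, 0, y])
      = 2 * k * \<mu>\<^sup>2 * x\<^sup>2 * y / sqrt (rad x y) ^ 3"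
proof -
  define r where "r = sqrt (rad x y)"
  have r: "0 < r" "r\<^sup>2 = rad x y" using assms by (simp_all add: r_def)
  \<comment> \<open>\<open>\<Gamma>\<close> along a line in position space, with \<open>n = Q\<^sub>1\<^sup>2 + Q\<^sub>2\<^sup>2\<close> and the two radicands \<open>f\<close> and \<open>g\<close>.\<close>
  have gen: "((\<lambda>h. p\<^sup>2 / (4 * m1) + q\<^sup>2 * n h * c - k * n h / sqrt (f h) - k * n h / sqrt (g h) - m1\<^sup>2 - E * n h)
      has_real_derivative q\<^sup>2 * n' * c - 2 * k * n' / r + k * n 0 * (f' + g') / (2 * r ^ 3) - E * n') (at 0)"
    if n: "(n has_real_derivative n') (at 0)" and f: "(f has_real_derivative f') (at 0)" "f 0 = rad x y"
      and g: "(g has_real_derivative g') (at 0)" "g 0 = rad x y" for n f g n' f' g'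
  proof -
    have quot: "((\<lambda>h. k * n h / sqrt (u h)) has_real_derivative k * n' / r - k * n 0 * u' / (2 * r ^ 3)) (at 0)"
      if u: "(u has_real_derivative u') (at 0)" "u 0 = rad x y" for u u'
    proof -
      have "((\<lambda>h. sqrt (u h)) has_real_derivative inverse r / 2 * u') (at 0)"
        using DERIV_chain2[OF DERIV_real_sqrt u(1)] u(2) assms by (simp add: r_def)
      from DERIV_divide[OF DERIV_cmult[OF n, of k] this]
      have "((\<lambda>h. k * n h / sqrt (u h)) has_real_derivative
          (k * n' * r - k * n 0 * (inverse r / 2 * u')) / (r * r)) (at 0)"
        using r(1) u(2) by (simp add: r_def)
      then show ?thesis
        by (rule DERIV_cong) (use r(1) in \<open>simp add: field_simps power3_eq_cube\<close>)
    qed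
    show ?thesis
      by (rule derivative_eq_intros n quot[OF f] quot[OF g] refl)+ (simp add: algebra_simps add_divide_distrib)
  qed
  have r2: "r\<^sup>2 = x ^ 4 / 4 + \<mu>\<^sup>2 * y\<^sup>2" using r(2) by (simp add: rad_def)
  note expand = partial_deriv_def Gamma_def radicand_plus_def radicand_minus_def Qbold_def axis_def
    k_def[symmetric] c_def[symmetric] \<mu>_def[symmetric]
  show "partial_deriv (\<lambda>Q. Gamma m1 m2 E Q (vector [p, 0, 0, q])) 1 (vector [x, 0, 0, y])
      = - (x * (- 2 * c * q\<^sup>2 + 4 * k * \<mu>\<^sup>2 * y\<^sup>2 / sqrt (rad x y) ^ 3 + 2 * E))"
  proof -
    define n f where "n h = (x + h)\<^sup>2" and "f h = 1 / 4 * ((x + h)\<^sup>2)\<^sup>2 + \<mu>\<^sup>2 * y\<^sup>2" for h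
    have "(n has_real_derivative 2 * x) (at 0)" "(f has_real_derivative x ^ 3) (at 0)"
      unfolding n_def f_def
      by (auto intro!: derivative_eq_intros simp: power2_eq_square power3_eq_cube)
    moreover have "f 0 = rad x y" by (simp add: f_def rad_def flip: power_mult)
    ultimately have "deriv (\<lambda>h. p\<^sup>2 / (4 * m1) + q\<^sup>2 * n h * c - k * n h / sqrt (f h) - k * n h / sqrt (f h) - m1\<^sup>2 - E * n h) 0
      = q\<^sup>2 * (2 * x) * c - 2 * k * (2 * x) / r + k * n 0 * (x ^ 3 + x ^ 3) / (2 * r ^ 3) - E * (2 * x)"
      by (intro DERIV_imp_deriv gen)
    moreover have "2 * k * (2 * x) / r = 4 * k * x * (x ^ 4 / 4 + \<mu>\<^sup>2 * y\<^sup>2) / r ^ 3"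
      unfolding r2[symmetric] using r(1) by (simp add: power2_eq_square power3_eq_cube)
    moreover have "q\<^sup>2 * (2 * x) * c - 4 * k * x * (x ^ 4 / 4 + \<mu>\<^sup>2 * y\<^sup>2) / r ^ 3
        + k * n 0 * (x ^ 3 + x ^ 3) / (2 * r ^ 3) - E * (2 * x)
      = - (x * (- 2 * c * q\<^sup>2 + 4 * k * \<mu>\<^sup>2 * y\<^sup>2 / r ^ 3 + 2 * E))"
      by (simp add: n_def algebra_simps add_divide_distrib power2_eq_square power3_eq_cube power4_eq_xxxx)
    moreover have "partial_deriv (\<lambda>Q. Gamma m1 m2 E Q (vector [p, 0, 0, q])) 1 (vector [x, 0, 0, y])
      = deriv (\<lambda>h. p\<^sup>2 / (4 * m1) + q\<^sup>2 * n h * c - k * n h / sqrt (f h) - k * n h / sqrt (f h) - m1\<^sup>2 - E * n h) 0"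
      by (simp add: expand n_def[abs_def] f_def[abs_def])
    ultimately show ?thesis by (simp only: r_def)
  qed
  show "partial_deriv (\<lambda>Q. Gamma m1 m2 E Q (vector [p, 0, 0, q])) 2 (vector [x, 0, 0, y]) = 0"
  proof -
    define n f g where "n h = x\<^sup>2 + h\<^sup>2"
      and "f h = 1 / 4 * (x\<^sup>2 + h\<^sup>2)\<^sup>2 + \<mu> * (2 * x * h * y) + \<mu>\<^sup>2 * y\<^sup>2"
      and "g h = 1 / 4 * (x\<^sup>2 + h\<^sup>2)\<^sup>2 - \<mu> * (2 * x * h * y) + \<mu>\<^sup>2 * y\<^sup>2" for h
    have "(n has_real_derivative 0) (at 0)" "(f has_real_derivative 2 * \<mu> * x * y) (at 0)"
      "(g has_real_derivative - (2 * \<mu> * x * y)) (at 0)"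
      unfolding n_def f_def g_def by (auto intro!: derivative_eq_intros)
    moreover have "f 0 = rad x y" "g 0 = rad x y" by (simp_all add: f_def g_def rad_def flip: power_mult)
    ultimately have "deriv (\<lambda>h. p\<^sup>2 / (4 * m1) + q\<^sup>2 * n h * c - k * n h / sqrt (f h) - k * n h / sqrt (g h) - m1\<^sup>2 - E * n h) 0
      = q\<^sup>2 * 0 * c - 2 * k * 0 / r + k * n 0 * (2 * \<mu> * x * y + - (2 * \<mu> * x * y)) / (2 * r ^ 3) - E * 0"
      by (intro DERIV_imp_deriv gen)
    then show ?thesis by (simp add: expand n_def[abs_def] f_def[abs_def] g_def[abs_def])
  qed
  show "partial_deriv (\<lambda>Q. Gamma m1 m2 E Q (vector [p, 0, 0, q])) 3 (vector [x, 0, 0, y]) = 0"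
  proof -
    define n f g where "n h = x\<^sup>2"
      and "f h = 1 / 4 * (x\<^sup>2)\<^sup>2 + \<mu> * (x\<^sup>2 * h) + \<mu>\<^sup>2 * (h\<^sup>2 + y\<^sup>2)"
      and "g h = 1 / 4 * (x\<^sup>2)\<^sup>2 - \<mu> * (x\<^sup>2 * h) + \<mu>\<^sup>2 * (h\<^sup>2 + y\<^sup>2)" for h :: real
    have "(n has_real_derivative 0) (at 0)" "(f has_real_derivative \<mu> * x\<^sup>2) (at 0)"
      "(g has_real_derivative - (\<mu> * x\<^sup>2)) (at 0)"
      unfolding n_def f_def g_def by (auto intro!: derivative_eq_intros)
    moreover have "f 0 = rad x y" "g 0 = rad x y" by (simp_all add: f_def g_def rad_def flip: power_mult)
    ultimately have "deriv (\<lambda>h. p\<^sup>2 / (4 * m1) + q\<^sup>2 * n h * c - k * n h / sqrt (f h) - k * n h / sqrt (g h) - m1\<^sup>2 - E * n h) 0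
      = q\<^sup>2 * 0 * c - 2 * k * 0 / r + k * n 0 * (\<mu> * x\<^sup>2 + - (\<mu> * x\<^sup>2)) / (2 * r ^ 3) - E * 0"
      by (intro DERIV_imp_deriv gen)
    then show ?thesis by (simp add: expand n_def[abs_def] f_def[abs_def] g_def[abs_def])
  qed
  show "partial_deriv (\<lambda>Q. Gamma m1 m2 E Q (vector [p, 0, 0, q])) 4 (vector [x, 0, 0, y])
      = 2 * k * \<mu>\<^sup>2 * x\<^sup>2 * y / sqrt (rad x y) ^ 3"
  proof -
    define n f where "n h = x\<^sup>2" and "f h = 1 / 4 * (x\<^sup>2)\<^sup>2 + \<mu>\<^sup>2 * (y + h)\<^sup>2" for h :: real
    have "(n has_real_derivative 0) (at 0)" "(f has_real_derivative 2 * \<mu>\<^sup>2 * y) (at 0)"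
      unfolding n_def f_def by (auto intro!: derivative_eq_intros)
    moreover have "f 0 = rad x y" by (simp add: f_def rad_def flip: power_mult)
    ultimately have "deriv (\<lambda>h. p\<^sup>2 / (4 * m1) + q\<^sup>2 * n h * c - k * n h / sqrt (f h) - k * n h / sqrt (f h) - m1\<^sup>2 - E * n h) 0
      = q\<^sup>2 * 0 * c - 2 * k * 0 / r + k * n 0 * (2 * \<mu>\<^sup>2 * y + 2 * \<mu>\<^sup>2 * y) / (2 * r ^ 3) - E * 0"
      by (intro DERIV_imp_deriv gen)
    then show ?thesis
      by (simp add: expand n_def[abs_def] f_def[abs_def] flip: r_def)
  qed
qed

lemma hamiltonian_solution_slice:
  assumes Z: "\<And>t. (Z has_vector_derivative trunc \<delta> M (Z t)) (at t)"
    and core: "\<And>t. Z t \<in> core \<delta> M" and \<delta>: "0 < \<delta>"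
  shows "hamiltonian_solution m1 m2 E (\<lambda>s. slice_embedding (Z s))"
proof -
  have "slice_embedding (Z s) \<in> Gamma_domain m1 m2 \<and>
       (\<forall>i. ((\<lambda>t. fst (slice_embedding (Z t)) $ i) has_real_derivative
            partial_deriv (\<lambda>P. Gamma m1 m2 E (fst (slice_embedding (Z s))) P) i (snd (slice_embedding (Z s)))) (at s) \<and>
         ((\<lambda>t. snd (slice_embedding (Z t)) $ i) has_real_derivative
            - partial_deriv (\<lambda>Q. Gamma m1 m2 E Q (snd (slice_embedding (Z s)))) i (fst (slice_embedding (Z s)))) (at s))" for s
  proof -
    have rad: "0 < rad (fst (Z s)) (fst (snd (Z s)))"
      using core[of s] \<delta> by (cases "Z s") (simp add: core_def)
    note d = solution_components[OF Z core[of s]]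
    show ?thesis
      unfolding forall_4 using d rad
      by (simp add: slice_embedding_def Gamma_domain_def radicand_slice partial_P partial_Q)
  qed
  then show ?thesis unfolding hamiltonian_solution_def by blast
qed

end

theorem theorem2p1:
  fixes m1 m2 E :: real
  assumes "m1 > 0" and "m2 > 0" and "2 * m1 + m2 = 3" and "E < 0"
  shows "\<exists>(s0::real) (\<zeta>1::real) (\<zeta>4::real) (\<zeta>8::real) (\<gamma> :: real \<Rightarrow> phase).
      s0 > 0 \<and> \<zeta>1 > 0 \<and> \<zeta>4 > 0 \<and> \<zeta>8 \<noteq> 0 \<and>
      hamiltonian_solution m1 m2 E \<gamma> \<and>
      (\<forall>s. \<gamma> (s + 4 * s0) = \<gamma> s) \<and>
      (\<forall>s. \<gamma> s \<in> zero_level m1 m2 E) \<and>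
      (\<forall>s. fst (\<gamma> s) $ 2 = 0 \<and> fst (\<gamma> s) $ 3 = 0 \<and> snd (\<gamma> s) $ 2 = 0 \<and> snd (\<gamma> s) $ 3 = 0) \<and>
      \<gamma> 0 = (vector [0, 0, 0, \<zeta>4], vector [2 * m1 powr (3 / 2), 0, 0, 0]) \<and>
      \<gamma> s0 = (vector [\<zeta>1, 0, 0, 0], vector [0, 0, 0, \<zeta>8]) \<and>
      strict_mono_on {0..s0} (\<lambda>s. fst (\<gamma> s) $ 1) \<and>
      strict_antimono_on {0..s0} (\<lambda>s. fst (\<gamma> s) $ 4) \<and>
      (\<forall>s. \<gamma> (2 * s0 - s) = - S_sym (\<gamma> s)) \<and>
      (\<forall>s. \<gamma> (- s) = S_sym (\<gamma> s))"
proof -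
  interpret isosceles m1 m2 E using assms by unfold_locales
  obtain \<delta> M a T Z where \<delta>: "0 < \<delta>" and M: "0 \<le> M" and T: "0 < T"
    and Z0: "Z 0 = (0, a, 2 * m1 powr (3 / 2), 0)"
    and Z: "\<And>t. (Z has_vector_derivative trunc \<delta> M (Z t)) (at t)"
    and core: "\<And>s. \<lbrakk>0 \<le> s; s \<le> T\<rbrakk> \<Longrightarrow> Z s \<in> core \<delta> M"
    and arc: "quadrant_arc m1 m2 E a T (\<lambda>s. fst (Z s)) (\<lambda>s. fst (snd (Z s)))
      (\<lambda>s. fst (snd (snd (Z s)))) (\<lambda>s. snd (snd (snd (Z s))))"
    and pos: "\<And>s. \<lbrakk>0 \<le> s; s < T\<rbrakk> \<Longrightarrow> 0 < fst (snd (Z s)) \<and> 0 < fst (snd (snd (Z s)))"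
    and yT: "fst (snd (Z T)) = 0" and pT: "fst (snd (snd (Z T))) = 0"
    by (rule quarter_orbit) (rule that)
  obtain L where L: "L-lipschitz_on UNIV (trunc \<delta> M)" using lipschitz_trunc[OF \<delta> M] .
  interpret A: quadrant_arc m1 m2 E a T "\<lambda>s. fst (Z s)" "\<lambda>s. fst (snd (Z s))"
    "\<lambda>s. fst (snd (snd (Z s)))" "\<lambda>s. snd (snd (snd (Z s)))" by (rule arc)
  have "reflect_x (Z 0) = Z 0" by (simp add: Z0 reflect_x_def)
  moreover have "reflect_y (Z T) = Z T" using yT pT by (simp add: reflect_y_def prod_eq_iff)
  ultimately have refl_x: "Z (- s) = reflect_x (Z s)" and refl_y: "Z (2 * T - s) = reflect_y (Z s)"
    and per: "Z (s + 4 * T) = Z s" for s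
    using symmetric_extension[OF L Z trunc_reflect[OF M]] by blast+
  have inv: "Z s \<in> zero_energy_core \<delta> M" for s
  proof (rule stays_in_zero_energy_core[OF T _ refl_x refl_y per])
    fix s assume "0 \<le> s" "s \<le> T"
    then show "Z s \<in> zero_energy_core \<delta> M"
      using core A.energy by (simp add: zero_energy_core_def case_prod_beta)
  qed
  then have core_all: "Z s \<in> core \<delta> M" for s
    unfolding zero_energy_core_def by (auto simp: case_prod_beta)
  define \<gamma> where "\<gamma> s = slice_embedding (Z s)" for s
  have "hamiltonian_solution m1 m2 E \<gamma>"
    unfolding \<gamma>_def by (rule hamiltonian_solution_slice[OF Z core_all \<delta>])
  moreover have "\<gamma> s \<in> zero_level m1 m2 E" for s
    using inv[of s] \<delta>
    by (simp add: \<gamma>_def slice_embedding_def zero_level_def Gamma_domain_def radicand_slice Gamma_slice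
        zero_energy_core_def core_def case_prod_beta)
  moreover have "strict_mono_on {0..T} (\<lambda>s. fst (\<gamma> s) $ 1)"
  proof (rule strict_mono_onI)
    fix s t assume st: "s \<in> {0..T}" "t \<in> {0..T}" "s < t"
    have "fst (Z s) < fst (Z t)"
    proof (rule DERIV_pos_imp_increasing_open[of s t "\<lambda>s. fst (Z s)"])
      fix u assume u: "s < u" "u < t"
      then show "\<exists>d. ((\<lambda>s. fst (Z s)) has_real_derivative d) (at u) \<and> 0 < d"
        using A.dx[of u] pos[of u] st m1
        by (intro exI[of _ "fst (snd (snd (Z u))) / (2 * m1)"]) simp
    next
      show "continuous_on {s..t} (\<lambda>s. fst (Z s))"
        using st by (intro continuous_at_imp_continuous_on ballI DERIV_isCont[OF A.dx]) auto
    qed (rule st(3))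
    then show "fst (\<gamma> s) $ 1 < fst (\<gamma> t) $ 1" by (simp add: \<gamma>_def slice_embedding_def)
  qed
  moreover have "strict_antimono_on {0..T} (\<lambda>s. fst (\<gamma> s) $ 4)"
  proof (rule monotone_onI)
    fix s t assume st: "s \<in> {0..T}" "t \<in> {0..T}" "s < t"
    have "fst (snd (Z t)) < fst (snd (Z s))"
    proof (rule DERIV_neg_imp_decreasing_open[of s t "\<lambda>s. fst (snd (Z s))"])
      fix u assume u: "s < u" "u < t"
      then have "snd (snd (snd (Z u))) < 0" "0 < fst (Z u)"
        using st pos by (auto intro!: A.q_neg A.x_pos)
      then have "2 * c * (fst (Z u))\<^sup>2 * snd (snd (snd (Z u))) < 0"
        using c_pos by (intro mult_pos_neg) auto
      then show "\<exists>d. ((\<lambda>s. fst (snd (Z s))) has_real_derivative d) (at u) \<and> d < 0"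
        using A.dy[of u] st u
        by (intro exI[of _ "2 * c * (fst (Z u))\<^sup>2 * snd (snd (snd (Z u)))"] conjI) auto
    next
      show "continuous_on {s..t} (\<lambda>s. fst (snd (Z s)))"
        using st by (intro continuous_at_imp_continuous_on ballI DERIV_isCont[OF A.dy]) auto
    qed (rule st(3))
    then show "fst (\<gamma> t) $ 4 < fst (\<gamma> s) $ 4" by (simp add: \<gamma>_def slice_embedding_def)
  qed
  moreover have "\<gamma> (- s) = S_sym (\<gamma> s)" "\<gamma> (2 * T - s) = - S_sym (\<gamma> s)" "\<gamma> (s + 4 * T) = \<gamma> s" for s
    by (simp_all add: \<gamma>_def slice_embedding_def S_sym_def refl_x refl_y per reflect_x_def reflect_y_def
        prod_eq_iff vec_eq_iff forall_4)
  moreover have "\<gamma> 0 = (vector [0, 0, 0, a], vector [2 * m1 powr (3 / 2), 0, 0, 0])"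
    by (simp add: \<gamma>_def slice_embedding_def Z0)
  moreover have "\<gamma> T = (vector [fst (Z T), 0, 0, 0], vector [0, 0, 0, snd (snd (snd (Z T)))])"
    by (simp add: \<gamma>_def slice_embedding_def yT pT)
  moreover have "0 < fst (Z T)" "snd (snd (snd (Z T))) \<noteq> 0"
    using A.x_pos[of T] A.q_neg[of T] T pos by auto
  moreover have "fst (\<gamma> s) $ 2 = 0 \<and> fst (\<gamma> s) $ 3 = 0 \<and> snd (\<gamma> s) $ 2 = 0 \<and> snd (\<gamma> s) $ 3 = 0" for s
    by (simp add: \<gamma>_def slice_embedding_def)
  ultimately show ?thesis using T A.a
    by (intro exI[of _ T] exI[of _ "fst (Z T)"] exI[of _ a] exI[of _ "snd (snd (snd (Z T)))"] exI[of _ \<gamma>]) blast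
qed

end
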